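(* Let $d\ge2$ be an integer and $\beta\ge\frac{1}{2\log2}$. Suppose $\mathcal{X}\subseteq\mathbb{T}^d$ (identified with a subset of $[-\frac12,\frac12)^d$) has cardinality $s$ and consists of clumps with parameters $(\infty,\tau,\lambda)$. Suppose $m\ge4s$, $\delta:=\Delta_1(\mathcal{X})\le\frac{\lambda}{m}$, and $\frac{2\beta d\lambda}{m}\le\tau\le\frac{1}{4d}$. Then $$\sigma_{\min}(\mathcal{F}_{Q_m,\mathcal{X}})\ge\sqrt{\frac2s}\,\Big(1-\frac12e^{1/(2\beta)}\Big)^{\lambda/2}\sqrt{|Q_{m/(2\lambda)}|}\,\Big(\frac{m\delta}{\lambda}\Big)^{\lambda-1},$$ $$\sigma_{\min}(\Phi_{Q_m,\mathcal{X}})\ge\sqrt{\frac2s}\,\Big(1-\frac12e^{1/(2\beta)}\Big)^{\lambda/2}\sqrt{|Q_{m/(2\lambda)}|_*}\,\Big(\frac{m\delta}{\lambda}\Big)^{\lambda-1}.$$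
   Context: $Q_m=\{x\in\mathbb{R}^d:|x|_\infty\le m\}$. For compact $\Omega\subset\mathbb{R}^d$, $|\Omega|$ is its Lebesgue measure and $|\Omega|_*=|\Omega\cap\mathbb{Z}^d|$ is the number of integer points in $\Omega$. For $\mathcal{X}=\{x_k\}_{k=1}^s$, $\mathcal{F}_{\Omega,\mathcal{X}}:\mathbb{C}^s\to L^2(\Omega)$ is $(\mathcal{F}_{\Omega,\mathcal{X}}u)(\omega)=\sum_{k=1}^s u_ke^{-2\pi i\omega\cdot x_k}$, and $\Phi_{\Omega,\mathcal{X}}=[e^{-2\pi i\omega\cdot x}]_{\omega\in\Omega\cap\mathbb{Z}^d,\,x\in\mathcal{X}}$. $\sigma_{\min}$ denotes the minimum of $\|\mathcal{F}_{\Omega,\mathcal{X}}u\|_{L^2(\Omega)}$ (respectively $|\Phi_{\Omega,\mathcal{X}}u|_2$) over $u\in\mathbb{C}^s$ with $|u|_2=1$. The minimum separation is $\Delta_p(\mathcal{X})=\min_{x\ne x'\in\mathcal{X}}|x-x'|_p$ ($+\infty$ if $\mathcal{X}$ is a single point). Clumps: $\mathcal{X}$ consists of clumps with parameters $(p,\tau,\lambda)$ if there exist an integer $r\ge1$ and disjoint subsets $\mathcal{C}_1,\dots,\mathcal{C}_r$ of $\mathcal{X}$ such that $\mathcal{X}=\mathcal{C}_1\cup\cdots\cup\mathcal{C}_r$, the $\ell^p$ distance between any two elements in the same $\mathcal{C}_k$ is at most $\tau$, $\max_{1\le k\le r}|\mathcal{C}_k|=\lambda$, and, if $r>1$, the $\ell^p$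 distance between different $\mathcal{C}_j$ and $\mathcal{C}_k$ exceeds $\tau$. Convention on metrics: in statements about $\mathcal{F}_{\Omega,\mathcal{X}}$, $|\cdot|_p$ is the usual $\ell^p$ norm on $\mathbb{R}^d$; in statements about $\Phi_{\Omega,\mathcal{X}}$, $\mathcal{X}$ is regarded as a subset of the torus $\mathbb{T}^d=(\mathbb{R}/\mathbb{Z})^d\cong[-\frac12,\frac12)^d$ and $|x|_p$ means $\min_{n\in\mathbb{Z}^d}|x+n|_p$. Hypotheses and conclusion are read in the metric corresponding to the operator. *)

theory Defs
  imports "HOL-Analysis.Analysis"
begin

text \<open>The norm \<open>|x|\<^sub>p\<close> for \<open>1 \<le> p \<le> \<infinity>\<close>.\<close>

definition lp_norm :: "ereal \<Rightarrow> real ^ 'd \<Rightarrow> real" where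
  "lp_norm p x =
     (if p = \<infinity> then infnorm x
      else (\<Sum>i\<in>UNIV. \<bar>x $ i\<bar> powr real_of_ereal p) powr (1 / real_of_ereal p))"

lemma lp_norm_1: "lp_norm 1 x = (\<Sum>i\<in>UNIV. \<bar>x $ i\<bar>)"
  by (simp add: lp_norm_def sum_nonneg)

definition int_lattice :: "(real ^ 'd) set" where
  "int_lattice = {n. \<forall>i. n $ i \<in> \<int>}"

text \<open>The induced norm on the torus; the infimum over the lattice is attained.\<close>

definition torus_lp_norm :: "ereal \<Rightarrow> real ^ 'd \<Rightarrow> real" where
  "torus_lp_norm p x = (INF n\<in>int_lattice. lp_norm p (x + n))"

definition torus_box :: "(real ^ 'd) set" where
  "torus_box = {x. \<forall>i. - 1/2 \<le> x $ i \<and> x $ i < 1/2}"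

definition cube :: "real \<Rightarrow> (real ^ 'd) set" where
  "cube m = {x. lp_norm \<infinity> x \<le> m}"

text \<open>
  The next two notions take the norm \<open>N\<close> as an argument, to be instantiated by
  \<open>lp_norm p\<close> or \<open>torus_lp_norm p\<close>. For finite \<open>X\<close> the infimum is a minimum; it is \<open>\<infinity>\<close>
  if \<open>X\<close> has at most one point.
\<close>

definition min_sep :: "(real ^ 'd \<Rightarrow> real) \<Rightarrow> (real ^ 'd) set \<Rightarrow> ereal" where
  "min_sep N X = (INF (x, y)\<in>{(x, y). x \<in> X \<and> y \<in> X \<and> x \<noteq> y}. ereal (N (x - y)))"

definition consists_of_clumps ::
  "(real ^ 'd \<Rightarrow> real) \<Rightarrow> real \<Rightarrow> nat \<Rightarrow> (real ^ 'd) set \<Rightarrow> bool" where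
  "consists_of_clumps N \<tau> lam X \<longleftrightarrow>
     (\<exists>(r::nat) C. r \<ge> 1 \<and> disjoint_family_on C {1..r} \<and> X = (\<Union>k\<in>{1..r}. C k) \<and>
        (\<forall>k\<in>{1..r}. \<forall>x\<in>C k. \<forall>y\<in>C k. N (x - y) \<le> \<tau>) \<and>
        Max ((\<lambda>k. card (C k)) ` {1..r}) = lam \<and>
        (\<forall>j\<in>{1..r}. \<forall>k\<in>{1..r}. j \<noteq> k \<longrightarrow> (\<forall>x\<in>C j. \<forall>y\<in>C k. N (x - y) > \<tau>)))"

text \<open>
  A coefficient vector indexed by the nodes is a function \<open>u\<close> on \<open>real ^ 'd\<close> of which
  only the values on \<open>X\<close> matter.
\<close>

definition fourier_op ::
  "(real ^ 'd) set \<Rightarrow> (real ^ 'd \<Rightarrow> complex) \<Rightarrow> real ^ 'd \<Rightarrow> complex" where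
  "fourier_op X u \<omega> = (\<Sum>x\<in>X. u x * exp (- 2 * pi * \<i> * complex_of_real (\<omega> \<bullet> x)))"

definition L2_norm :: "(real ^ 'd) set \<Rightarrow> (real ^ 'd \<Rightarrow> complex) \<Rightarrow> real" where
  "L2_norm \<Omega> f = sqrt (LINT \<omega>:\<Omega>|lebesgue. (cmod (f \<omega>))\<^sup>2)"

definition l2_norm :: "(real ^ 'd) set \<Rightarrow> (real ^ 'd \<Rightarrow> complex) \<Rightarrow> real" where
  "l2_norm A f = sqrt (\<Sum>a\<in>A. (cmod (f a))\<^sup>2)"

definition fourier_matrix :: "real ^ 'd \<Rightarrow> real ^ 'd \<Rightarrow> complex" where
  "fourier_matrix \<omega> x = exp (- 2 * pi * \<i> * complex_of_real (\<omega> \<bullet> x))"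

text \<open>
  The infima below run over the unit sphere of a finite-dimensional space, so for finite
  nonempty \<open>X\<close> and compact \<open>\<Omega>\<close> they are minima. The rows of the matrix are indexed by
  \<open>\<Omega> \<inter> int_lattice\<close>.
\<close>

definition sigma_min_F :: "(real ^ 'd) set \<Rightarrow> (real ^ 'd) set \<Rightarrow> real" where
  "sigma_min_F \<Omega> X = (INF u\<in>{u. l2_norm X u = 1}. L2_norm \<Omega> (fourier_op X u))"

definition sigma_min_Phi :: "(real ^ 'd) set \<Rightarrow> (real ^ 'd) set \<Rightarrow> real" where
  "sigma_min_Phi \<Omega> X =
     (INF u\<in>{u. l2_norm X u = 1}.
        l2_norm (\<Omega> \<inter> int_lattice) (\<lambda>\<omega>. \<Sum>x\<in>X. fourier_matrix \<omega> x * u x))"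

end

theory Submission
  imports Defs "HOL-Real_Asymp.Real_Asymp"
begin

text \<open>
  Write \<open>M = m / (2 lam)\<close> and \<open>e = exp (1 / (2 \<beta>))\<close>, and let \<open>u\<close> be a unit coefficient
  vector. Some node \<open>x0\<close> carries \<open>|u x0|\<^sup>2 \<ge> 1/s\<close>. The samples \<open>fourier_op X u \<omega>\<close> must be
  large because \<open>u x0\<close> can be recovered from them: multiplying \<open>u\<close> by a trigonometric polynomial
  \<open>g\<close> amounts to taking a combination of shifted samples, so the sampled \<open>\<ell>\<^sup>2\<close> norm grows at most
  by the \<open>\<ell>\<^sup>1\<close> norm of the coefficients of \<open>g\<close> while the sampled cube shrinks by the degree of
  \<open>g\<close> (\<open>multiplier_trigonometric\<close>). It remains to choose a cheap \<open>g\<close> with \<open>g x0 = 1\<close> that kills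
  all nodes except a well separated set containing \<open>x0\<close>, and to handle that set directly.

  The other nodes in the clump of \<open>x0\<close>, at most \<open>lam - 1\<close> of them, are killed one at a time by
  factors \<open>1 - cis (2 pi n (t - y))\<close>; the frequency \<open>n\<close> is a multiple of the sign vector of
  \<open>x0 - y\<close>, so that the \<open>\<ell>\<^sup>1\<close> norm \<open>|x0 - y|\<^sub>1 \<ge> \<delta>\<close> governs the cost \<open>1 / (sqrt 2 M \<delta>)\<close>
  (\<open>single_node_multiplier\<close>). The nodes of all the other clumps are distributed over \<open>lam\<close> sets,
  each with at most one node from every clump. Together with \<open>x0\<close> each set is \<open>\<tau>\<close>-separated, and
  \<open>\<tau>\<close> is so large compared with \<open>1/M\<close> that the characters at separated nodes are nearly orthogonal
  over a cube of half-width about \<open>M\<close>: \<open>separated_energy\<close> gives the lower bound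
  \<open>(2 - e) |Q|\<^sub>* |u|\<^sup>2\<close> for the cube \<open>Q\<close> of half-width \<open>M\<close>. By duality (\<open>trigonometric_interpolation\<close>) such a set is killed at cost
  \<open>1 / sqrt (2 - e)\<close>. Doing this for \<open>lam - 1\<close> sets and applying \<open>separated_energy\<close> to the last
  one gives \<open>node_coefficient_bound\<close>, and \<open>torus_clump_bound\<close> follows.

  The near orthogonality comes from a weight on the lattice: in each coordinate a trapezoid, i.e. the
  convolution of two intervals, whose transform decays quadratically. Cutting the torus into
  cubes of side \<open>\<tau>\<close> around a node, each cube contains at most one node, hence the off-diagonal
  part of the Gram matrix is dominated by the \<open>d\<close>-th power of a convergent one-dimensional sum
  (\<open>cell_packing\<close>). The trapezoid occupies half-width \<open>3 M / 2\<close> per separated set instead of \<open>M\<close>;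
  there is room for this since the \<open>lam - 1\<close> local factors, centred, take only half-width \<open>M / 2\<close> each.

  The statement on Euclidean space is deduced from the one on the torus. Shrinking the nodes by a factor
  \<open>R\<close> turns the torus norms into Euclidean norms and the integer lattice into a lattice of spacing
  \<open>1/R\<close>. The torus bound holds for every translate of this lattice; averaging over translates turns
  the sums into an integral over the cube (\<open>lattice_averaging\<close>), and then \<open>R\<close> tends to infinity.
\<close>

section \<open>Characters and integer boxes\<close>

lemma fourier_matrix_cis: "fourier_matrix \<omega> x = cis (- 2 * pi * (\<omega> \<bullet> x))"
  by (simp add: fourier_matrix_def cis_conv_exp mult_ac)

lemma norm_fourier_matrix [simp]: "cmod (fourier_matrix \<omega> x) = 1"
  by (simp add: fourier_matrix_cis)

lemma fourier_matrix_add_left: "fourier_matrix (\<omega> + \<eta>) x = fourier_matrix \<omega> x * fourier_matrix \<eta> x"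
  by (simp add: fourier_matrix_cis cis_mult inner_add_left distrib_left)

lemma fourier_matrix_add_right: "fourier_matrix \<omega> (x + y) = fourier_matrix \<omega> x * fourier_matrix \<omega> y"
  by (simp add: fourier_matrix_cis cis_mult inner_add_right distrib_left)

lemma fourier_matrix_0 [simp]: "fourier_matrix 0 x = 1" "fourier_matrix \<omega> 0 = 1"
  by (simp_all add: fourier_matrix_cis)

lemma cnj_fourier_matrix: "cnj (fourier_matrix \<omega> x) = fourier_matrix \<omega> (- x)"
  by (simp add: fourier_matrix_cis cis_cnj)

lemma inner_int_lattice: "a \<in> int_lattice \<Longrightarrow> b \<in> int_lattice \<Longrightarrow> a \<bullet> b \<in> \<int>"
  unfolding int_lattice_def inner_vec_def by (auto intro!: Ints_sum Ints_mult)

lemma fourier_matrix_int_lattice: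
  assumes "\<omega> \<in> int_lattice" "n \<in> int_lattice"
  shows "fourier_matrix \<omega> n = 1"
proof -
  obtain k where "\<omega> \<bullet> n = of_int k"
    using inner_int_lattice[OF assms] by (auto elim: Ints_cases)
  then show ?thesis
    using cis_multiple_2pi[of "- of_int k"] by (simp add: fourier_matrix_cis mult_ac)
qed

definition int_box :: "int \<Rightarrow> int \<Rightarrow> (real ^ 'd) set" where
  "int_box lo hi = {n \<in> int_lattice. \<forall>i. of_int lo \<le> n $ i \<and> n $ i \<le> of_int hi}"

lemma bij_betw_int_box:
  "bij_betw (\<lambda>g. \<chi> i. of_int (g i)) (PiE UNIV (\<lambda>_::'d. {lo..hi})) (int_box lo hi :: (real ^ 'd) set)"
proof (rule bij_betwI)
  show "(\<lambda>g. \<chi> i. of_int (g i)) \<in> (PiE UNIV (\<lambda>_::'d. {lo..hi})) \<rightarrow> (int_box lo hi :: (real ^ 'd) set)"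
    by (auto simp: int_box_def int_lattice_def PiE_def Pi_def)
  show "(\<lambda>n i. \<lfloor>n $ i\<rfloor>) \<in> (int_box lo hi :: (real ^ 'd) set) \<rightarrow> (PiE UNIV (\<lambda>_::'d. {lo..hi}))"
    by (auto simp: int_box_def int_lattice_def PiE_def Pi_def le_floor_iff floor_le_iff)
      (smt (verit) Ints_cases of_int_floor_cancel)
  show "(\<lambda>i. \<lfloor>(\<chi> i. of_int (g i) :: real ^ 'd) $ i\<rfloor>) = g" for g :: "'d \<Rightarrow> int" by simp
  show "(\<chi> i. of_int \<lfloor>n $ i\<rfloor>) = n" if "n \<in> int_box lo hi" for n :: "real ^ 'd"
    using that by (simp add: vec_eq_iff int_box_def int_lattice_def)
qed

lemma finite_int_box [simp]: "finite (int_box lo hi :: (real ^ 'd) set)"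
  using bij_betw_finite[OF bij_betw_int_box[of lo hi, where 'd='d]] by (simp add: finite_PiE)

lemma sum_prod_int_box:
  fixes f :: "'d::finite \<Rightarrow> int \<Rightarrow> 'c::comm_semiring_1"
  shows "(\<Sum>n\<in>(int_box lo hi :: (real ^ 'd) set). \<Prod>i\<in>UNIV. f i \<lfloor>n $ i\<rfloor>) =
    (\<Prod>i\<in>UNIV. \<Sum>k\<in>{lo..hi}. f i k)"
proof -
  have "(\<Sum>n\<in>(int_box lo hi :: (real ^ 'd) set). \<Prod>i\<in>UNIV. f i \<lfloor>n $ i\<rfloor>) =
        (\<Sum>g\<in>PiE UNIV (\<lambda>_::'d. {lo..hi}). \<Prod>i\<in>UNIV. f i (g i))"
    by (subst sum.reindex_bij_betw[OF bij_betw_int_box, symmetric]) simp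
  also have "\<dots> = (\<Prod>i\<in>UNIV. \<Sum>k\<in>{lo..hi}. f i k)"
    by (subst prod_sum_PiE) auto
  finally show ?thesis .
qed

lemma card_int_box: "card (int_box lo hi :: (real ^ 'd) set) = nat (hi - lo + 1) ^ CARD('d)"
  using bij_betw_same_card[OF bij_betw_int_box[of lo hi, where 'd='d]]
  by (simp add: card_PiE)

lemma infnorm_le_iff: "infnorm (x :: real ^ 'd) \<le> a \<longleftrightarrow> (\<forall>i. \<bar>x $ i\<bar> \<le> a)"
proof -
  have "infnorm x \<le> a" if "\<forall>i. \<bar>x $ i\<bar> \<le> a"
    unfolding infnorm_cart using that by (intro cSup_least) auto
  then show ?thesis using component_le_infnorm_cart order_trans by blast
qed

lemma lp_norm_infty: "lp_norm \<infinity> x = infnorm x"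
  by (simp add: lp_norm_def)

lemma cube_eq: "cube m = {x. \<forall>i. \<bar>x $ i\<bar> \<le> m}"
  by (simp add: cube_def lp_norm_infty infnorm_le_iff)

lemma cube_int_lattice: "cube m \<inter> int_lattice = int_box (- \<lfloor>m\<rfloor>) \<lfloor>m\<rfloor>"
proof -
  have "\<bar>of_int k :: real\<bar> \<le> m \<longleftrightarrow> (of_int (- \<lfloor>m\<rfloor>) :: real) \<le> of_int k \<and> (of_int k :: real) \<le> of_int \<lfloor>m\<rfloor>" for k
  proof -
    have "\<bar>of_int k :: real\<bar> \<le> m \<longleftrightarrow> k \<le> \<lfloor>m\<rfloor> \<and> - k \<le> \<lfloor>m\<rfloor>"
      by (simp only: le_floor_iff of_int_minus abs_le_iff)
    also have "\<dots> \<longleftrightarrow> - \<lfloor>m\<rfloor> \<le> k \<and> k \<le> \<lfloor>m\<rfloor>" by (metis minus_le_iff)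
    finally show ?thesis by (simp only: of_int_le_iff)
  qed
  note * = this
  have "\<bar>t\<bar> \<le> m \<longleftrightarrow> (of_int (- \<lfloor>m\<rfloor>)) \<le> t \<and> t \<le> of_int \<lfloor>m\<rfloor>" if "t \<in> \<int>" for t :: real
    using that by (cases rule: Ints_cases) (simp only: *)
  then show ?thesis
    by (auto simp: cube_eq int_box_def int_lattice_def)
qed

section \<open>A trapezoidal weight and its transform\<close>

lemma one_minus_cis: "cmod (1 - cis a) = 2 * \<bar>sin (a / 2)\<bar>"
proof -
  have "cmod (1 - cis a)^2 = (1 - cos a)^2 + (sin a)^2"
    by (simp add: cmod_power2)
  also have "\<dots> = 2 - 2 * cos a"
    using sin_cos_squared_add[of a] by (simp add: power2_eq_square algebra_simps)
  also have "\<dots> = (2 * \<bar>sin (a/2)\<bar>)^2"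
    using cos_double_sin[of "a/2"] by (simp add: power_mult_distrib)
  finally show ?thesis by (rule power2_eq_imp_eq) auto
qed

text \<open>
  The geometric sum telescopes against \<open>1 - cis a\<close>, whose modulus is \<open>2 |sin (a/2)|\<close>.
  The product form covers the zeros of the sine.
\<close>

lemma dirichlet_kernel_bound:
  assumes "lo \<le> hi + 1"
  shows "cmod (\<Sum>k\<in>{lo..hi}. cis (of_int k * a)) * \<bar>sin (a / 2)\<bar> \<le> 1"
proof -
  have tele: "(1 - cis a) * (\<Sum>k\<in>{lo..hi}. cis (of_int k * a)) = cis (of_int lo * a) - cis (of_int (hi + 1) * a)"
  proof -
    have "lo - 1 \<le> hi" using assms by simp
    then show ?thesis
    proof (induction hi rule: int_ge_induct)
    case (step hi)
    have "{lo..hi + 1} = insert (hi + 1) {lo..hi}" using step by auto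
    then have "(\<Sum>k\<in>{lo..hi + 1}. cis (of_int k * a)) = cis (of_int (hi + 1) * a) + (\<Sum>k\<in>{lo..hi}. cis (of_int k * a))"
      by simp
    moreover have "cis a * cis (of_int (hi + 1) * a) = cis (of_int (hi + 1 + 1) * a)"
      by (simp add: cis_mult algebra_simps)
    moreover have "(1 - cis a) * (cis (of_int (hi + 1) * a) + (\<Sum>k\<in>{lo..hi}. cis (of_int k * a))) =
        cis (of_int lo * a) - cis a * cis (of_int (hi + 1) * a)"
      unfolding distrib_left step.IH by (simp add: left_diff_distrib)
    ultimately show ?case by simp
  qed auto
  qed
  have "2 * \<bar>sin (a/2)\<bar> * cmod (\<Sum>k\<in>{lo..hi}. cis (of_int k * a)) \<le> 2"
    unfolding one_minus_cis[symmetric] norm_mult[symmetric] tele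
    using norm_triangle_ineq4[of "cis (of_int lo * a)" "cis (of_int (hi + 1) * a)"] by simp
  then show ?thesis by (simp add: mult.commute)
qed

text \<open>
  Convolution of the indicator of \<open>{-P..P}\<close> with the uniform probability on \<open>{-q..q}\<close>: it keeps the
  mass \<open>2 P + 1\<close> and lives on \<open>{-(P+q)..P+q}\<close>, and its transform is a product
  of two Dirichlet kernels, hence of size \<open>1 / sin\<^sup>2\<close>.
\<close>

definition trapezoid :: "int \<Rightarrow> int \<Rightarrow> int \<Rightarrow> real" where
  "trapezoid P q k = (\<Sum>b\<in>{-q..q}. of_bool (\<bar>k - b\<bar> \<le> P)) / of_int (2 * q + 1)"

lemma trapezoid_bounds:
  assumes "q \<ge> 0"
  shows "0 \<le> trapezoid P q k" "trapezoid P q k \<le> 1"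
proof -
  show "0 \<le> trapezoid P q k" using assms by (auto simp: trapezoid_def intro!: divide_nonneg_nonneg sum_nonneg)
  have "(\<Sum>b\<in>{-q..q}. of_bool (\<bar>k - b\<bar> \<le> P)) \<le> (\<Sum>b\<in>{-q..q}. 1::real)"
    by (intro sum_mono) auto
  then show "trapezoid P q k \<le> 1" using assms by (simp add: trapezoid_def divide_simps)
qed

lemma trapezoid_transform:
  fixes f :: "int \<Rightarrow> complex"
  assumes "P \<ge> 0" "q \<ge> 0"
  shows "(\<Sum>k\<in>{-(P+q)..P+q}. trapezoid P q k * f k) =
    (\<Sum>b\<in>{-q..q}. \<Sum>a\<in>{-P..P}. f (a + b)) / of_int (2 * q + 1)"
proof -
  have *: "(\<Sum>k\<in>{-(P+q)..P+q}. of_bool (\<bar>k - b\<bar> \<le> P) * f k) = (\<Sum>a\<in>{-P..P}. f (a + b))"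
    if "b \<in> {-q..q}" for b
  proof -
    have "(\<Sum>a\<in>{-P..P}. f (a + b)) = (\<Sum>k\<in>{b-P..b+P}. f k)"
      by (rule sum.reindex_bij_witness[of _ "\<lambda>k. k - b" "\<lambda>a. a + b"]) auto
    also have "\<dots> = (\<Sum>k\<in>{-(P+q)..P+q}. of_bool (\<bar>k - b\<bar> \<le> P) * f k)"
      using that by (intro sum.mono_neutral_cong_left) auto
    finally show ?thesis ..
  qed
  have "(\<Sum>k\<in>{-(P+q)..P+q}. trapezoid P q k * f k) =
     (\<Sum>k\<in>{-(P+q)..P+q}. \<Sum>b\<in>{-q..q}. of_bool (\<bar>k - b\<bar> \<le> P) * f k) / of_int (2 * q + 1)"
    by (simp add: trapezoid_def sum_divide_distrib[symmetric] sum_distrib_right[symmetric])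
  also have "(\<Sum>k\<in>{-(P+q)..P+q}. \<Sum>b\<in>{-q..q}. of_bool (\<bar>k - b\<bar> \<le> P) * f k) =
     (\<Sum>b\<in>{-q..q}. \<Sum>a\<in>{-P..P}. f (a + b))"
    by (subst sum.swap) (rule sum.cong[OF refl *])
  finally show ?thesis .
qed

lemma sum_trapezoid:
  assumes "P \<ge> 0" "q \<ge> 0"
  shows "(\<Sum>k\<in>{-(P+q)..P+q}. trapezoid P q k) = of_int (2 * P + 1)"
proof -
  have "complex_of_real (\<Sum>k\<in>{-(P+q)..P+q}. trapezoid P q k) = of_real (of_int (2 * P + 1))"
  proof -
    have "complex_of_int (2 * q + 1) \<noteq> 0" unfolding of_int_eq_0_iff by presburger
    moreover have "(\<Sum>b\<in>{-q..q}. \<Sum>a\<in>{-P..P}. 1) = complex_of_int (2 * q + 1) * of_int (2 * P + 1)"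
      using assms by simp
    ultimately show ?thesis
      using trapezoid_transform[OF assms, of "\<lambda>_. 1"] by simp
  qed
  then show ?thesis by (simp only: of_real_eq_iff)
qed

text \<open>
  Equivalent to \<open>sin (arctan y) \<le> sin y\<close>. This keeps the exact leading constant \<open>1 / y\<^sup>2\<close>, for which
  Jordan's inequality would be too weak in \<open>packing_constant_le\<close>.
\<close>

lemma inverse_sin_square_le:
  fixes y :: real
  assumes "0 < y" "y \<le> pi / 2"
  shows "1 / (sin y)^2 \<le> 1 / y^2 + 1"
proof -
  have "arctan y \<le> y" using arctan_le_self assms by simp
  moreover have "0 < arctan y" using assms by simp
  ultimately have "sin (arctan y) \<le> sin y" using assms arctan_lbound[of y] by (intro sin_monotone_2pi_le) auto
  then have "y / sqrt (1 + y^2) \<le> sin y" by (simp add: sin_arctan)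
  moreover have "0 < y / sqrt (1 + y^2)" using assms by (simp add: divide_pos_pos add_pos_nonneg)
  ultimately have "(y / sqrt (1 + y^2))^2 \<le> (sin y)^2" "0 < (sin y)^2"
    by (auto intro!: power_mono)
  then have "y^2 / (1 + y^2) \<le> (sin y)^2" by (simp add: power_divide add_nonneg_nonneg)
  moreover have "0 < y^2 / (1+y^2)" using assms by (simp add: add_pos_nonneg)
  ultimately have "1 / (sin y)^2 \<le> 1 / (y^2 / (1 + y^2))"
    by (intro frac_le) auto
  also have "\<dots> = 1 / y^2 + 1" using assms by (simp add: field_simps)
  finally show ?thesis .
qed

lemma trapezoid_transform_bound:
  assumes "P \<ge> 0" "q \<ge> 0" and "sin (a / 2) \<noteq> 0"
  shows "cmod (\<Sum>k\<in>{-(P+q)..P+q}. trapezoid P q k * cis (of_int k * a)) \<le>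
    1 / (of_int (2 * q + 1) * (sin (a / 2))^2)"
proof -
  have "(\<Sum>b\<in>{-q..q}. \<Sum>c\<in>{-P..P}. cis (of_int (c + b) * a)) =
      (\<Sum>b\<in>{-q..q}. cis (of_int b * a)) * (\<Sum>c\<in>{-P..P}. cis (of_int c * a))"
    by (auto simp: sum_product cis_mult distrib_right add.commute intro!: sum.cong)
  moreover have "cmod (\<Sum>b\<in>{-q..q}. cis (of_int b * a)) \<le> 1 / \<bar>sin (a/2)\<bar>"
    "cmod (\<Sum>b\<in>{-P..P}. cis (of_int b * a)) \<le> 1 / \<bar>sin (a/2)\<bar>"
    using dirichlet_kernel_bound[of "-q" q a] dirichlet_kernel_bound[of "-P" P a] assms
    by (simp_all add: pos_le_divide_eq)
  ultimately have "cmod (\<Sum>b\<in>{-q..q}. \<Sum>c\<in>{-P..P}. cis (of_int (c + b) * a)) \<le> 1 / \<bar>sin (a/2)\<bar> * (1 / \<bar>sin (a/2)\<bar>)"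
    by (simp only: norm_mult) (intro mult_mono, auto)
  also have "\<dots> = 1 / (sin (a / 2))^2" by (simp add: power2_eq_square)
  finally have "cmod (\<Sum>b\<in>{-q..q}. \<Sum>c\<in>{-P..P}. cis (of_int (c + b) * a)) / of_int (2 * q + 1) \<le>
      1 / (sin (a / 2))^2 / of_int (2 * q + 1)"
    using assms by (intro divide_right_mono) auto
  moreover have "cmod (of_int (2 * q + 1)) = of_int (2 * q + 1)" using assms by (metis norm_of_int abs_of_nonneg add_nonneg_nonneg mult_nonneg_nonneg of_int_0_le_iff zero_le_numeral zero_le_one)
  ultimately show ?thesis
    using assms by (subst trapezoid_transform) (auto simp only: norm_divide divide_divide_eq_left mult.commute)
qed

lemma trapezoid_transform_le:
  assumes "P \<ge> 0" "q \<ge> 0"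
  shows "cmod (\<Sum>k\<in>{-(P+q)..P+q}. trapezoid P q k * cis (of_int k * a)) \<le> of_int (2 * P + 1)"
proof -
  have "cmod (\<Sum>k\<in>{-(P+q)..P+q}. trapezoid P q k * cis (of_int k * a)) \<le>
     (\<Sum>k\<in>{-(P+q)..P+q}. trapezoid P q k)"
    using trapezoid_bounds[OF assms(2)] by (intro sum_norm_le) (simp add: norm_mult)
  then show ?thesis using sum_trapezoid[OF assms] by simp
qed

text \<open>
  The first term is \<open>4\<close>; the others telescope because \<open>(n - 1/2)\<^sup>2 \<ge> (n - 1) n\<close>. (The full series sums to
  \<open>pi\<^sup>2 / 2\<close>.)
\<close>

lemma sum_inverse_half_square:
  "(\<Sum>n=1..R. 1 / (real n - 1/2)^2) \<le> 5"
proof -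
  have "(\<Sum>n=1..R. 1 / (real n - 1/2)^2) \<le> 5 - 1 / real R" if "R \<ge> 1" for R :: nat
    using that
  proof (induction R rule: dec_induct)
    case (step n)
    have "1 / (real (Suc n) - 1/2)^2 \<le> 1 / (real n * real (Suc n))"
    proof (rule frac_le)
      show "0 < real n * real (Suc n)" using step by simp
    qed (auto simp: power2_eq_square algebra_simps)
    also have "\<dots> = 1 / real n - 1 / real (Suc n)"
      using step by (simp add: field_simps)
    finally show ?case using step by simp
  qed (simp add: power2_eq_square)
  from this[of R] show ?thesis by (cases "R = 0") (auto intro: order_trans)
qed

section \<open>Norms on the torus\<close>

lemma lp_norm_nonneg: "0 \<le> lp_norm p x"
  by (simp add: lp_norm_def infnorm_pos_le)

lemma torus_lp_norm_le: "n \<in> int_lattice \<Longrightarrow> torus_lp_norm p x \<le> lp_norm p (x + n)"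
  unfolding torus_lp_norm_def by (rule cINF_lower) (auto intro!: bdd_belowI2[of _ 0] lp_norm_nonneg)

lemma zero_int_lattice [simp]: "0 \<in> int_lattice"
  by (simp add: int_lattice_def)

lemma int_lattice_diff: "a \<in> int_lattice \<Longrightarrow> b \<in> int_lattice \<Longrightarrow> a - b \<in> int_lattice"
  by (simp add: int_lattice_def)

lemma torus_lp_norm_nonneg: "0 \<le> torus_lp_norm p x"
  unfolding torus_lp_norm_def by (rule cINF_greatest) (auto intro: lp_norm_nonneg zero_int_lattice)

text \<open>
  The representative modulo the integer lattice with all coordinates in \<open>[-1/2, 1/2]\<close>. It minimises every
  coordinate simultaneously, so it attains the infimum in \<open>torus_lp_norm\<close>.
\<close>

definition torus_rep :: "real ^ 'd \<Rightarrow> real ^ 'd" where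
  "torus_rep w = (\<chi> i. w $ i - of_int (round (w $ i)))"

lemma torus_rep_le_half: "\<bar>torus_rep w $ i\<bar> \<le> 1 / 2"
  using of_int_round_abs_le[of "w $ i"] by (simp add: torus_rep_def abs_minus_commute)

lemma torus_rep_diff: "torus_rep w - w \<in> int_lattice"
  by (simp add: torus_rep_def int_lattice_def)

lemma torus_rep_le:
  assumes "n \<in> int_lattice"
  shows "\<bar>torus_rep w $ i\<bar> \<le> \<bar>(w + n) $ i\<bar>"
proof -
  obtain k where "n $ i = of_int k" using assms by (auto simp: int_lattice_def elim: Ints_cases)
  then show ?thesis using round_diff_minimal[of "w $ i" "- k"] by (simp add: torus_rep_def)
qed

lemma fourier_matrix_torus_rep:
  assumes "\<omega> \<in> int_lattice"
  shows "fourier_matrix \<omega> (torus_rep w) = fourier_matrix \<omega> w"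
  using fourier_matrix_add_right[of \<omega> w "torus_rep w - w"]
    fourier_matrix_int_lattice[OF assms torus_rep_diff] by simp

lemma torus_lp_norm_infty: "torus_lp_norm \<infinity> w = infnorm (torus_rep w)"
proof (rule antisym)
  show "torus_lp_norm \<infinity> w \<le> infnorm (torus_rep w)"
    using torus_lp_norm_le[OF torus_rep_diff, of \<infinity> w w] by (simp add: lp_norm_infty)
  show "infnorm (torus_rep w) \<le> torus_lp_norm \<infinity> w"
    unfolding torus_lp_norm_def
  proof (rule cINF_greatest)
    fix n :: "real ^ 'a" assume "n \<in> int_lattice"
    then show "infnorm (torus_rep w) \<le> lp_norm \<infinity> (w + n)"
      unfolding lp_norm_infty infnorm_le_iff
      using torus_rep_le component_le_infnorm_cart order_trans by blast
  qed (auto intro: zero_int_lattice)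
qed

lemma torus_lp_norm_1: "torus_lp_norm 1 w = (\<Sum>i\<in>UNIV. \<bar>torus_rep w $ i\<bar>)"
proof (rule antisym)
  show "torus_lp_norm 1 w \<le> (\<Sum>i\<in>UNIV. \<bar>torus_rep w $ i\<bar>)"
    using torus_lp_norm_le[OF torus_rep_diff, of 1 w w] by (simp add: lp_norm_1)
  show "(\<Sum>i\<in>UNIV. \<bar>torus_rep w $ i\<bar>) \<le> torus_lp_norm 1 w"
    unfolding torus_lp_norm_def
  proof (rule cINF_greatest)
    fix n :: "real ^ 'a" assume "n \<in> int_lattice"
    then show "(\<Sum>i\<in>UNIV. \<bar>torus_rep w $ i\<bar>) \<le> lp_norm 1 (w + n)"
      unfolding lp_norm_1 by (intro sum_mono torus_rep_le)
  qed (auto intro: zero_int_lattice)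
qed

section \<open>Packing of separated nodes\<close>

definition trapezoid_weight :: "int \<Rightarrow> int \<Rightarrow> real ^ 'd \<Rightarrow> real" where
  "trapezoid_weight P q n = (\<Prod>i\<in>UNIV. trapezoid P q \<lfloor>n $ i\<rfloor>)"

lemma trapezoid_weight_bounds:
  assumes "q \<ge> 0"
  shows "0 \<le> trapezoid_weight P q n" "trapezoid_weight P q n \<le> 1"
  unfolding trapezoid_weight_def using trapezoid_bounds[OF assms]
  by (auto intro!: prod_nonneg prod_le_1)

lemma sum_trapezoid_weight:
  assumes "P \<ge> 0" "q \<ge> 0"
  shows "(\<Sum>n\<in>(int_box (-(P+q)) (P+q) :: (real ^ 'd) set). trapezoid_weight P q n) = of_int (2 * P + 1) ^ CARD('d)"
  unfolding trapezoid_weight_def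
  by (subst sum_prod_int_box) (simp only: sum_trapezoid[OF assms] prod_constant)

lemma fourier_matrix_prod:
  assumes "n \<in> int_lattice"
  shows "fourier_matrix n x = (\<Prod>i\<in>UNIV. cis (of_int \<lfloor>n $ i\<rfloor> * (- 2 * pi * x $ i)))"
proof -
  have *: "cis (\<Sum>i\<in>A. f i) = (\<Prod>i\<in>A. cis (f i))" if "finite A" for A :: "'a set" and f
    using that by (induction A rule: finite_induct) (simp_all add: cis_mult[symmetric])
  have "of_int \<lfloor>n $ i\<rfloor> = n $ i" for i using assms by (simp add: int_lattice_def)
  then have "(\<Prod>i\<in>UNIV. cis (of_int \<lfloor>n $ i\<rfloor> * (- 2 * pi * x $ i))) = cis (\<Sum>i\<in>UNIV. n $ i * (- 2 * pi * x $ i))"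
    by (simp only: *[OF finite])
  also have "(\<Sum>i\<in>UNIV. n $ i * (- 2 * pi * x $ i)) = - 2 * pi * (n \<bullet> x)"
    by (simp add: inner_vec_def sum_distrib_left sum_negf[symmetric] mult_ac)
  finally show ?thesis by (simp only: fourier_matrix_cis)
qed

lemma trapezoid_weight_transform:
  fixes x :: "real ^ 'd"
  shows "(\<Sum>n\<in>int_box (-(P+q)) (P+q). trapezoid_weight P q n * fourier_matrix n x) =
    (\<Prod>i\<in>UNIV. \<Sum>k\<in>{-(P+q)..P+q}. trapezoid P q k * cis (of_int k * (- 2 * pi * x $ i)))"
proof -
  have "(\<Sum>n\<in>int_box (-(P+q)) (P+q). trapezoid_weight P q n * fourier_matrix n x) =
    (\<Sum>n\<in>int_box (-(P+q)) (P+q). \<Prod>i\<in>UNIV. trapezoid P q \<lfloor>n $ i\<rfloor> * cis (of_int \<lfloor>n $ i\<rfloor> * (- 2 * pi * x $ i)))"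
  proof (rule sum.cong[OF refl])
    fix n :: "real ^ 'd" assume "n \<in> int_box (-(P+q)) (P+q)"
    then have "n \<in> int_lattice" by (simp add: int_box_def)
    then show "trapezoid_weight P q n * fourier_matrix n x = (\<Prod>i\<in>UNIV. trapezoid P q \<lfloor>n $ i\<rfloor> * cis (of_int \<lfloor>n $ i\<rfloor> * (- 2 * pi * x $ i)))"
      unfolding trapezoid_weight_def fourier_matrix_prod[OF \<open>n \<in> int_lattice\<close>] by (simp only: prod.distrib of_real_prod)
  qed
  then show ?thesis
    by (simp only: sum_prod_int_box[where f = "\<lambda>i k. complex_of_real (trapezoid P q k) * cis (of_int k * (- 2 * pi * x $ i))"])
qed

text \<open>
  Bound for the normalised transform of the trapezoid at a coordinate \<open>t\<close> with \<open>round (t / \<tau>) = k\<close>,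
  see \<open>trapezoid_transform_cell\<close>.
\<close>

definition cell_bound :: "int \<Rightarrow> int \<Rightarrow> real \<Rightarrow> int \<Rightarrow> real" where
  "cell_bound P q \<tau> k = (if k = 0 then 1 else
     (1 / (pi\<^sup>2 * \<tau>\<^sup>2 * (of_int \<bar>k\<bar> - 1/2)\<^sup>2) + 1) / of_int ((2 * P + 1) * (2 * q + 1)))"

lemma cell_bound_nonneg: "P \<ge> 0 \<Longrightarrow> q \<ge> 0 \<Longrightarrow> 0 \<le> cell_bound P q \<tau> k"
  by (simp add: cell_bound_def)

lemma trapezoid_transform_cell:
  assumes "P \<ge> 0" "q \<ge> 0" "\<tau> > 0" "\<bar>t\<bar> \<le> 1/2"
  shows "cmod (\<Sum>k\<in>{-(P+q)..P+q}. trapezoid P q k * cis (of_int k * (- 2 * pi * t))) \<le>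
    of_int (2 * P + 1) * cell_bound P q \<tau> (round (t / \<tau>))"
proof (cases "round (t / \<tau>) = 0")
  case True
  then show ?thesis using trapezoid_transform_le[OF assms(1,2), of "- 2 * pi * t"]
    by (simp only: True cell_bound_def refl if_True mult_1_right)
next
  case False
  define k where "k = round (t / \<tau>)"
  have k1: "1 \<le> \<bar>k\<bar>" using False by (simp add: k_def)
  then have "1 \<le> real_of_int \<bar>k\<bar>" by linarith
  have "\<bar>of_int k - t / \<tau>\<bar> \<le> 1/2" unfolding k_def by (rule of_int_round_abs_le)
  then have "of_int \<bar>k\<bar> - 1/2 \<le> \<bar>t / \<tau>\<bar>" unfolding of_int_abs by linarith
  then have t1: "(of_int \<bar>k\<bar> - 1/2) * \<tau> \<le> \<bar>t\<bar>" using assms(3) by (simp add: field_simps)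
  have pos: "0 < (of_int \<bar>k\<bar> - 1/2) * \<tau>" using assms(3) \<open>1 \<le> real_of_int \<bar>k\<bar>\<close> by simp
  define y where "y = pi * \<bar>t\<bar>"
  have y: "0 < y" "y \<le> pi / 2" using t1 pos assms(4) by (auto simp: y_def)
  have siny: "0 < sin y" using y by (intro sin_gt_zero) auto
  have "(sin (- 2 * pi * t / 2))^2 = (sin y)^2"
    by (cases "t \<ge> 0") (auto simp: y_def)
  then have s2: "(sin ((- 2 * pi * t) / 2))^2 = (sin y)^2" by simp
  then have "sin ((- 2 * pi * t) / 2) \<noteq> 0" using siny by (metis less_numeral_extra(3) power_zero_numeral zero_less_power)
  from trapezoid_transform_bound[OF assms(1,2) this] s2
  have "cmod (\<Sum>k\<in>{-(P+q)..P+q}. trapezoid P q k * cis (of_int k * (- 2 * pi * t))) \<le> 1 / (sin y)^2 / of_int (2 * q + 1)"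
    by (simp only: divide_divide_eq_left mult.commute)
  also have "1 / (sin y)^2 \<le> 1 / (pi\<^sup>2 * \<tau>\<^sup>2 * (of_int \<bar>k\<bar> - 1/2)\<^sup>2) + 1"
  proof -
    have "1 / (sin y)^2 \<le> 1 / y^2 + 1" by (rule inverse_sin_square_le[OF y])
    also have "1 / y^2 \<le> 1 / (pi * ((of_int \<bar>k\<bar> - 1/2) * \<tau>))^2"
    proof (intro frac_le)
      show "(pi * ((of_int \<bar>k\<bar> - 1/2) * \<tau>))\<^sup>2 \<le> y^2"
        unfolding y_def using t1 pos by (intro power_mono mult_left_mono) auto
      show "0 < (pi * ((of_int \<bar>k\<bar> - 1/2) * \<tau>))\<^sup>2"
        by (intro zero_less_power mult_pos_pos[OF pi_gt_zero pos])
    qed auto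
    also have "(pi * ((of_int \<bar>k\<bar> - 1/2) * \<tau>))^2 = pi\<^sup>2 * \<tau>\<^sup>2 * (of_int \<bar>k\<bar> - 1/2)\<^sup>2"
      by (simp add: power_mult_distrib mult_ac)
    finally show ?thesis by simp
  qed
  also have "(1 / (pi\<^sup>2 * \<tau>\<^sup>2 * (of_int \<bar>k\<bar> - 1/2)\<^sup>2) + 1) / of_int (2 * q + 1) = of_int (2 * P + 1) * cell_bound P q \<tau> k"
  proof -
    have "real_of_int (2 * P + 1) \<noteq> 0" unfolding of_int_eq_0_iff by presburger
    moreover have "k \<noteq> 0" using k1 by auto
    ultimately show ?thesis by (simp only: cell_bound_def of_int_mult if_False) (simp del: of_int_add of_int_mult)
  qed
  finally show ?thesis using assms by (simp add: k_def divide_right_mono)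
qed

lemma sum_cell_bound:
  assumes "P \<ge> 0" "q \<ge> 0" "\<tau> > 0"
  shows "(\<Sum>k\<in>{-int R..int R}. cell_bound P q \<tau> k) \<le>
    1 + (10 / (pi\<^sup>2 * \<tau>\<^sup>2) + 2 * real R) / of_int ((2 * P + 1) * (2 * q + 1))"
proof -
  define D where "D = real_of_int ((2 * P + 1) * (2 * q + 1))"
  have D: "D > 0" unfolding D_def of_int_0_less_iff using assms by simp
  have "(\<Sum>k\<in>{-int R..int R}. cell_bound P q \<tau> k) = 1 + 2 * (\<Sum>n=1..R. cell_bound P q \<tau> (int n))"
  proof (induction R)
    case 0 show ?case by (simp add: cell_bound_def)
  next
    case (Suc R)
    have "{- int (Suc R)..int (Suc R)} = insert (- int (Suc R)) (insert (int (Suc R)) {-int R..int R})" by auto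
    moreover have "cell_bound P q \<tau> (- int (Suc R)) = cell_bound P q \<tau> (int (Suc R))" by (simp add: cell_bound_def)
    ultimately show ?case using Suc by simp
  qed
  also have "(\<Sum>n=1..R. cell_bound P q \<tau> (int n)) = (\<Sum>n=1..R. (1 / (pi\<^sup>2 * \<tau>\<^sup>2) * (1 / (real n - 1/2)\<^sup>2) + 1) / D)"
    by (intro sum.cong) (auto simp: cell_bound_def D_def)
  also have "\<dots> = (1 / (pi\<^sup>2 * \<tau>\<^sup>2) * (\<Sum>n=1..R. 1 / (real n - 1/2)\<^sup>2) + real R) / D"
    by (simp add: sum_divide_distrib[symmetric] sum.distrib sum_distrib_left)
  also have "\<dots> \<le> (1 / (pi\<^sup>2 * \<tau>\<^sup>2) * 5 + real R) / D"
    using D sum_inverse_half_square[of R] by (intro divide_right_mono add_right_mono mult_left_mono) auto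
  finally show ?thesis unfolding D_def[symmetric] by (simp add: add_divide_distrib)
qed

text \<open>
  Index the cubes of side \<open>\<tau>\<close> around \<open>z0\<close> by vectors in \<open>\<int>\<^sup>d\<close>. Two nodes in one cube would be at distance
  at most \<open>\<tau>\<close>, so the sum over nodes is at most a sum over the cubes other than the central one, which
  belongs to \<open>z0\<close>. The bound is a product over coordinates, so the sum over all cubes is the \<open>d\<close>-th power
  of a one-dimensional sum.
\<close>

lemma cell_packing:
  fixes Z :: "(real ^ 'd) set"
  assumes "P \<ge> 0" "q \<ge> 0" "\<tau> > 0" "finite Z" "z0 \<in> Z"
    and sep: "\<And>z z'. z \<in> Z \<Longrightarrow> z' \<in> Z \<Longrightarrow> z \<noteq> z' \<Longrightarrow> \<tau> < torus_lp_norm \<infinity> (z - z')"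
  shows "(\<Sum>z\<in>Z - {z0}. cmod (\<Sum>n\<in>int_box (-(P+q)) (P+q). trapezoid_weight P q n * fourier_matrix n (z - z0)))
    \<le> of_int (2 * P + 1) ^ CARD('d) *
      ((1 + (10 / (pi\<^sup>2 * \<tau>\<^sup>2) + (1 / \<tau> + 1)) / of_int ((2 * P + 1) * (2 * q + 1))) ^ CARD('d) - 1)"
proof -
  define cell where "cell z i = round (torus_rep (z - z0) $ i / \<tau>)" for z i
  define R where "R = nat \<lfloor>1 / (2 * \<tau>) + 1/2\<rfloor>"
  define G where "G = PiE UNIV (\<lambda>_::'d. {-int R..int R})"
  \<comment> \<open>Two nodes in one cell would have representatives at distance at most \<open>\<tau>\<close> in every coordinate.\<close>
  have inj: "inj_on cell Z"
  proof (rule inj_onI, rule ccontr)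
    fix z z' assume z: "z \<in> Z" "z' \<in> Z" "cell z = cell z'" "z \<noteq> z'"
    define w where "w = torus_rep (z - z0) - torus_rep (z' - z0)"
    have "w - (z - z') = (torus_rep (z - z0) - (z - z0)) - (torus_rep (z' - z0) - (z' - z0))"
      by (simp add: w_def)
    also have "\<dots> \<in> int_lattice"
      by (intro int_lattice_diff torus_rep_diff)
    finally have "torus_lp_norm \<infinity> (z - z') \<le> infnorm w"
      using torus_lp_norm_le[of "w - (z - z')" \<infinity> "z - z'"] by (simp add: lp_norm_infty)
    also have "infnorm w \<le> \<tau>"
      unfolding infnorm_le_iff
    proof
      fix i
      have c: "round (torus_rep (z - z0) $ i / \<tau>) = round (torus_rep (z' - z0) $ i / \<tau>)"
        using z(3) by (simp add: cell_def fun_eq_iff)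
      have "\<bar>torus_rep (z - z0) $ i / \<tau> - torus_rep (z' - z0) $ i / \<tau>\<bar> \<le> 1"
        using of_int_round_abs_le[of "torus_rep (z - z0) $ i / \<tau>"]
          of_int_round_abs_le[of "torus_rep (z' - z0) $ i / \<tau>"] unfolding c by linarith
      then show "\<bar>w $ i\<bar> \<le> \<tau>" using assms(3)
        by (simp add: w_def diff_divide_distrib[symmetric])
    qed
    finally show False using sep[OF z(1,2,4)] by simp
  qed
  have cell0: "cell z0 = (\<lambda>_. 0)" by (rule ext) (simp add: cell_def torus_rep_def)
  have cellG: "cell z \<in> G" for z
  proof -
    have "\<bar>cell z i\<bar> \<le> int R" for i
    proof -
      have "\<bar>torus_rep (z - z0) $ i / \<tau>\<bar> \<le> 1 / (2 * \<tau>)"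
        using torus_rep_le_half[of "z - z0" i] assms(3) by (simp add: field_simps)
      then have "of_int \<bar>cell z i\<bar> \<le> 1 / (2 * \<tau>) + 1/2"
        using of_int_round_abs_le[of "torus_rep (z - z0) $ i / \<tau>"] unfolding cell_def of_int_abs by linarith
      then have "\<bar>cell z i\<bar> \<le> \<lfloor>1 / (2 * \<tau>) + 1/2\<rfloor>" by (simp only: le_floor_iff)
      then show ?thesis unfolding R_def by linarith
    qed
    then have "- int R \<le> cell z i \<and> cell z i \<le> int R" for i
      by (simp add: abs_le_iff minus_le_iff)
    then show ?thesis by (simp add: G_def PiE_def Pi_def)
  qed
  have "(\<Sum>z\<in>Z - {z0}. cmod (\<Sum>n\<in>int_box (-(P+q)) (P+q). trapezoid_weight P q n * fourier_matrix n (z - z0)))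
     \<le> (\<Sum>z\<in>Z - {z0}. of_int (2 * P + 1) ^ CARD('d) * (\<Prod>i\<in>UNIV. cell_bound P q \<tau> (cell z i)))"
  proof (rule sum_mono)
    fix z assume "z \<in> Z - {z0}"
    have "(\<Sum>n\<in>int_box (-(P+q)) (P+q). trapezoid_weight P q n * fourier_matrix n (z - z0)) =
      (\<Sum>n\<in>int_box (-(P+q)) (P+q). trapezoid_weight P q n * fourier_matrix n (torus_rep (z - z0)))"
      by (intro sum.cong refl arg_cong2[where f="(*)"] fourier_matrix_torus_rep[symmetric]) (auto simp: int_box_def)
    also have "cmod \<dots> \<le> (\<Prod>i\<in>(UNIV::'d set). of_int (2 * P + 1) * cell_bound P q \<tau> (cell z i))"
      unfolding trapezoid_weight_transform prod_norm[symmetric] cell_def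
      using assms(1-3) torus_rep_le_half by (intro prod_mono conjI norm_ge_zero trapezoid_transform_cell) auto
    also have "\<dots> = of_int (2 * P + 1) ^ CARD('d) * (\<Prod>i\<in>UNIV. cell_bound P q \<tau> (cell z i))"
      by (simp add: prod.distrib)
    finally show "cmod (\<Sum>n\<in>int_box (-(P+q)) (P+q). trapezoid_weight P q n * fourier_matrix n (z - z0)) \<le> \<dots>" .
  qed
  also have "\<dots> = of_int (2 * P + 1) ^ CARD('d) * (\<Sum>z\<in>Z - {z0}. \<Prod>i\<in>UNIV. cell_bound P q \<tau> (cell z i))"
    by (simp add: sum_distrib_left)
  also have "(\<Sum>z\<in>Z - {z0}. \<Prod>i\<in>UNIV. cell_bound P q \<tau> (cell z i)) =
      (\<Sum>g\<in>cell ` (Z - {z0}). \<Prod>i\<in>UNIV. cell_bound P q \<tau> (g i))"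
    using inj by (subst sum.reindex) (auto intro: inj_on_subset)
  also have "\<dots> \<le> (\<Sum>g\<in>G - {\<lambda>_. 0}. \<Prod>i\<in>UNIV. cell_bound P q \<tau> (g i))"
  proof (rule sum_mono2)
    show "finite (G - {\<lambda>_. 0})" by (simp add: G_def finite_PiE)
    show "cell ` (Z - {z0}) \<subseteq> G - {\<lambda>_. 0}"
    proof (rule image_subsetI)
      fix z assume "z \<in> Z - {z0}"
      then have "cell z \<noteq> cell z0" using inj_onD[OF inj, of z z0] assms(5) by blast
      then show "cell z \<in> G - {\<lambda>_. 0}" using cellG[of z] unfolding cell0 by blast
    qed
  qed (auto intro!: prod_nonneg cell_bound_nonneg assms)
  also have "\<dots> = (\<Sum>g\<in>G. \<Prod>i\<in>UNIV. cell_bound P q \<tau> (g i)) - 1"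
  proof -
    have "(\<lambda>_. 0) \<in> G" using cellG[of z0] cell0 by simp
    then show ?thesis
      by (subst sum_diff1) (simp_all add: G_def finite_PiE cell_bound_def)
  qed
  also have "(\<Sum>g\<in>G. \<Prod>i\<in>UNIV. cell_bound P q \<tau> (g i)) = (\<Sum>k\<in>{-int R..int R}. cell_bound P q \<tau> k) ^ CARD('d)"
    unfolding G_def by (subst prod_sum_PiE[symmetric]) auto
  also have "\<dots> \<le> (1 + (10 / (pi\<^sup>2 * \<tau>\<^sup>2) + (1 / \<tau> + 1)) / of_int ((2 * P + 1) * (2 * q + 1))) ^ CARD('d)"
  proof (rule power_mono)
    have "real R \<le> 1 / (2 * \<tau>) + 1/2" unfolding R_def using assms(3) by (simp add: le_floor_iff)
    then have "2 * real R \<le> 1 / \<tau> + 1" by simp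
    then have "(10 / (pi\<^sup>2 * \<tau>\<^sup>2) + 2 * real R) / of_int ((2 * P + 1) * (2 * q + 1)) \<le>
       (10 / (pi\<^sup>2 * \<tau>\<^sup>2) + (1 / \<tau> + 1)) / of_int ((2 * P + 1) * (2 * q + 1))"
      using assms by (intro divide_right_mono) auto
    then show "(\<Sum>k\<in>{-int R..int R}. cell_bound P q \<tau> k) \<le>
      1 + (10 / (pi\<^sup>2 * \<tau>\<^sup>2) + (1 / \<tau> + 1)) / of_int ((2 * P + 1) * (2 * q + 1))"
      using sum_cell_bound[OF assms(1-3), of R] by linarith
  qed (auto intro!: sum_nonneg cell_bound_nonneg assms)
  finally show ?thesis using assms by (simp add: mult_left_mono)
qed

section \<open>Lower energy bounds and interpolation\<close>

lemma fourier_op_eq: "fourier_op X u \<omega> = (\<Sum>x\<in>X. u x * fourier_matrix \<omega> x)"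
  by (simp add: fourier_op_def fourier_matrix_def)

text \<open>
  Gershgorin's argument for the Gram matrix of the characters: the diagonal entries equal the total weight and
  every off-diagonal row sum is at most \<open>\<eta>\<close>.
\<close>

lemma weighted_energy_lower_bound:
  fixes W :: "real ^ 'd \<Rightarrow> real"
  assumes "finite Z"
    and off: "\<And>z. z \<in> Z \<Longrightarrow> (\<Sum>z'\<in>Z - {z}. cmod (\<Sum>n\<in>A. W n * fourier_matrix n (z' - z))) \<le> \<eta>"
  shows "((\<Sum>n\<in>A. W n) - \<eta>) * (\<Sum>z\<in>Z. (cmod (u z))\<^sup>2) \<le> (\<Sum>n\<in>A. W n * (cmod (fourier_op Z u n))\<^sup>2)"
proof -
  define K where "K w = (\<Sum>n\<in>A. complex_of_real (W n) * fourier_matrix n w)" for w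
  define \<kappa> where "\<kappa> z z' = (if z = z' then 0 else cmod (K (z' - z)))" for z z'
  have K_minus: "K (- w) = cnj (K w)" for w
    by (simp add: K_def cnj_fourier_matrix)
  have \<kappa>_sym: "\<kappa> z z' = \<kappa> z' z" for z z'
    using K_minus[of "z - z'"] by (simp add: \<kappa>_def)
  have \<kappa>_nonneg: "0 \<le> \<kappa> z z'" for z z' by (simp add: \<kappa>_def)
  have \<kappa>_sum: "(\<Sum>z'\<in>Z. \<kappa> z z') \<le> \<eta>" if "z \<in> Z" for z
  proof -
    have "(\<Sum>z'\<in>Z. \<kappa> z z') = (\<Sum>z'\<in>Z - {z}. cmod (K (z' - z)))"
    proof -
      have "(\<Sum>z'\<in>Z. \<kappa> z z') = \<kappa> z z + (\<Sum>z'\<in>Z - {z}. \<kappa> z z')"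
        using that assms(1) by (intro sum.remove)
      also have "(\<Sum>z'\<in>Z - {z}. \<kappa> z z') = (\<Sum>z'\<in>Z - {z}. cmod (K (z' - z)))"
        by (intro sum.cong) (auto simp: \<kappa>_def)
      finally show ?thesis by (simp add: \<kappa>_def)
    qed
    then show ?thesis using off[OF that] by (simp add: K_def)
  qed
  have expand: "complex_of_real (\<Sum>n\<in>A. W n * (cmod (fourier_op Z u n))\<^sup>2) = (\<Sum>z\<in>Z. \<Sum>z'\<in>Z. u z' * cnj (u z) * K (z' - z))"
  proof -
    have fm: "fourier_matrix n z' * fourier_matrix n (- z) = fourier_matrix n (z' - z)" for n z z'
      using fourier_matrix_add_right[of n z' "- z"] by simp
    have "complex_of_real (\<Sum>n\<in>A. W n * (cmod (fourier_op Z u n))\<^sup>2) =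
       (\<Sum>n\<in>A. W n * (fourier_op Z u n * cnj (fourier_op Z u n)))"
      by (simp only: of_real_sum of_real_mult complex_norm_square)
    also have "\<dots> = (\<Sum>n\<in>A. \<Sum>z\<in>Z. \<Sum>z'\<in>Z. u z' * cnj (u z) * (W n * fourier_matrix n (z' - z)))"
      by (simp add: fourier_op_eq sum_product sum_distrib_left cnj_fourier_matrix fm[symmetric] mult_ac)
    also have "\<dots> = (\<Sum>z\<in>Z. \<Sum>n\<in>A. \<Sum>z'\<in>Z. u z' * cnj (u z) * (W n * fourier_matrix n (z' - z)))"
      by (rule sum.swap)
    also have "\<dots> = (\<Sum>z\<in>Z. \<Sum>z'\<in>Z. \<Sum>n\<in>A. u z' * cnj (u z) * (W n * fourier_matrix n (z' - z)))"
      by (intro sum.cong refl sum.swap)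
    also have "\<dots> = (\<Sum>z\<in>Z. \<Sum>z'\<in>Z. u z' * cnj (u z) * K (z' - z))"
      by (simp add: K_def sum_distrib_left)
    finally show ?thesis .
  qed
  have K0: "K 0 = of_real (\<Sum>n\<in>A. W n)" by (simp add: K_def)
  have entry: "(if z = z' then (\<Sum>n\<in>A. W n) * (cmod (u z))\<^sup>2 else 0) - ((cmod (u z))\<^sup>2 + (cmod (u z'))\<^sup>2) / 2 * \<kappa> z z'
      \<le> Re (u z' * cnj (u z) * K (z' - z))" for z z'
  proof (cases "z = z'")
    case True
    have "u z * cnj (u z) * K 0 = of_real ((cmod (u z))\<^sup>2 * (\<Sum>n\<in>A. W n))"
      by (simp only: K0 complex_norm_square[symmetric] of_real_mult of_real_power)
    then show ?thesis using True by (simp add: \<kappa>_def mult.commute del: of_real_mult of_real_sum)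
  next
    case False
    have "- Re (u z' * cnj (u z) * K (z' - z)) \<le> cmod (u z' * cnj (u z) * K (z' - z))"
      using abs_Re_le_cmod[of "u z' * cnj (u z) * K (z' - z)"] by linarith
    also have "\<dots> = (cmod (u z) * cmod (u z')) * \<kappa> z z'"
      using False by (simp add: norm_mult \<kappa>_def)
    also have "\<dots> \<le> ((cmod (u z))\<^sup>2 + (cmod (u z'))\<^sup>2) / 2 * \<kappa> z z'"
      using sum_squares_bound[of "cmod (u z)" "cmod (u z')"] by (intro mult_right_mono \<kappa>_nonneg) simp
    finally show ?thesis using False by simp
  qed
  have half: "(\<Sum>z\<in>Z. \<Sum>z'\<in>Z. (cmod (u z))\<^sup>2 * \<kappa> z z') \<le> \<eta> * (\<Sum>z\<in>Z. (cmod (u z))\<^sup>2)"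
    unfolding sum_distrib_left[symmetric] using \<kappa>_sum
    by (subst sum_distrib_left) (auto intro!: sum_mono mult_right_mono simp: mult.commute[of "(cmod _)\<^sup>2"])
  have half': "(\<Sum>z\<in>Z. \<Sum>z'\<in>Z. (cmod (u z'))\<^sup>2 * \<kappa> z z') = (\<Sum>z\<in>Z. \<Sum>z'\<in>Z. (cmod (u z))\<^sup>2 * \<kappa> z z')"
    by (subst sum.swap) (simp add: \<kappa>_sym)
  have "(\<Sum>n\<in>A. W n) * (\<Sum>z\<in>Z. (cmod (u z))\<^sup>2) - (\<Sum>z\<in>Z. \<Sum>z'\<in>Z. ((cmod (u z))\<^sup>2 + (cmod (u z'))\<^sup>2) / 2 * \<kappa> z z') =
     (\<Sum>z\<in>Z. \<Sum>z'\<in>Z. (if z = z' then (\<Sum>n\<in>A. W n) * (cmod (u z))\<^sup>2 else 0) - ((cmod (u z))\<^sup>2 + (cmod (u z'))\<^sup>2) / 2 * \<kappa> z z')"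
    using assms(1) by (simp add: sum_subtractf sum_distrib_left)
  also have "\<dots> \<le> (\<Sum>z\<in>Z. \<Sum>z'\<in>Z. Re (u z' * cnj (u z) * K (z' - z)))"
    by (intro sum_mono entry)
  also have "\<dots> = (\<Sum>n\<in>A. W n * (cmod (fourier_op Z u n))\<^sup>2)"
    using arg_cong[OF expand, of Re] by (simp only: Re_sum Re_complex_of_real)
  finally have main: "(\<Sum>n\<in>A. W n) * (\<Sum>z\<in>Z. (cmod (u z))\<^sup>2) - (\<Sum>z\<in>Z. \<Sum>z'\<in>Z. ((cmod (u z))\<^sup>2 + (cmod (u z'))\<^sup>2) / 2 * \<kappa> z z')
     \<le> (\<Sum>n\<in>A. W n * (cmod (fourier_op Z u n))\<^sup>2)" .
  have "(\<Sum>z\<in>Z. \<Sum>z'\<in>Z. ((cmod (u z))\<^sup>2 + (cmod (u z'))\<^sup>2) / 2 * \<kappa> z z') =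
     ((\<Sum>z\<in>Z. \<Sum>z'\<in>Z. (cmod (u z))\<^sup>2 * \<kappa> z z') + (\<Sum>z\<in>Z. \<Sum>z'\<in>Z. (cmod (u z'))\<^sup>2 * \<kappa> z z')) / 2"
    by (simp add: sum.distrib[symmetric] sum_divide_distrib algebra_simps add_divide_distrib)
  then show ?thesis using main half half' by (simp add: algebra_simps)
qed

text \<open>
  Orthogonal projection onto the span of finitely many vectors, for a positive semidefinite weighted inner
  product, by Gram-Schmidt. If the new direction has length zero, then it is orthogonal to everything
  already and no correction is made.
\<close>

lemma exists_orthogonal_residual:
  fixes W :: "'n \<Rightarrow> real" and v :: "'a \<Rightarrow> 'n \<Rightarrow> complex"
  assumes "finite A" "\<And>n. n \<in> A \<Longrightarrow> 0 \<le> W n" "finite Y"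
  shows "\<exists>a. \<forall>y\<in>Y. (\<Sum>n\<in>A. W n * (f n - (\<Sum>z\<in>Y. a z * v z n)) * cnj (v y n)) = 0"
  using \<open>finite Y\<close>
proof (induction Y arbitrary: f rule: finite_induct)
  case (insert y0 Y)
  define ip where "ip f g = (\<Sum>n\<in>A. complex_of_real (W n) * f n * cnj (g n))" for f g
  have ip_diff: "ip (\<lambda>n. f n - c * h n) g = ip f g - c * ip h g" for f g h c
    by (simp add: ip_def sum_subtractf[symmetric] sum_distrib_left algebra_simps)
  have ip_cong: "(\<And>n. n \<in> A \<Longrightarrow> f n = f' n) \<Longrightarrow> ip f g = ip f' g" for f f' g
    by (simp add: ip_def)
  obtain a where a: "\<And>y. y \<in> Y \<Longrightarrow> ip (\<lambda>n. f n - (\<Sum>z\<in>Y. a z * v z n)) (v y) = 0"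
    using insert.IH[of f] unfolding ip_def by blast
  obtain b where b: "\<And>y. y \<in> Y \<Longrightarrow> ip (\<lambda>n. v y0 n - (\<Sum>z\<in>Y. b z * v z n)) (v y) = 0"
    using insert.IH[of "v y0"] unfolding ip_def by blast
  define r where "r n = f n - (\<Sum>z\<in>Y. a z * v z n)" for n
  \<comment> \<open>Only the part \<open>p\<close> of the new vector orthogonal to the old ones matters.\<close>
  define p where "p n = v y0 n - (\<Sum>z\<in>Y. b z * v z n)" for n
  have v0: "v y0 n = p n + (\<Sum>z\<in>Y. b z * v z n)" for n by (simp add: p_def)
  have ip_right: "ip g (v y0) = ip g p" if "\<And>y. y \<in> Y \<Longrightarrow> ip g (v y) = 0" for g
  proof -
    have "ip g (v y0) = ip g p + (\<Sum>z\<in>Y. cnj (b z) * ip g (v z))"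
      unfolding ip_def v0
      by (simp add: distrib_left sum.distrib sum_distrib_left sum.swap[of _ Y A] mult_ac)
    then show ?thesis using that by simp
  qed
  have r: "ip r (v y) = 0" if "y \<in> Y" for y using a[OF that] by (simp add: r_def[abs_def])
  have p: "ip p (v y) = 0" if "y \<in> Y" for y using b[OF that] by (simp add: p_def[abs_def])
  obtain c where c: "ip r p = c * ip p p"
  proof (cases "ip p p = 0")
    case False
    then show ?thesis using that[of "ip r p / ip p p"] by simp
  next
    case True
    have "ip p p = of_real (\<Sum>n\<in>A. W n * (cmod (p n))\<^sup>2)"
      by (simp only: ip_def of_real_sum of_real_mult complex_norm_square mult.assoc)
    then have "(\<Sum>n\<in>A. W n * (cmod (p n))\<^sup>2) = 0" using True by (metis of_real_eq_0_iff)
    then have "\<forall>n\<in>A. W n * (cmod (p n))\<^sup>2 = 0"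
      using assms by (subst (asm) sum_nonneg_eq_0_iff) auto
    then have "ip r p = 0" by (auto simp: ip_def intro!: sum.neutral)
    then show ?thesis using that[of 0] by simp
  qed
  define a' where "a' z = (if z = y0 then c else a z - c * b z)" for z
  have res: "f n - (\<Sum>z\<in>insert y0 Y. a' z * v z n) = r n - c * p n" for n
  proof -
    have "(\<Sum>z\<in>Y. a' z * v z n) = (\<Sum>z\<in>Y. (a z - c * b z) * v z n)"
      using insert.hyps by (intro sum.cong) (auto simp: a'_def)
    also have "\<dots> = (\<Sum>z\<in>Y. a z * v z n) - c * (\<Sum>z\<in>Y. b z * v z n)"
      by (simp add: sum_subtractf sum_distrib_left algebra_simps)
    finally show ?thesis using insert.hyps by (simp add: r_def p_def a'_def algebra_simps)
  qed
  have "ip (\<lambda>n. r n - c * p n) (v y) = 0" if "y \<in> insert y0 Y" for y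
    using that r p ip_right[of r] ip_right[of p] c by (auto simp: ip_diff)
  then show ?case by (intro exI[of _ a']) (simp only: res ip_def, blast)
qed auto

text \<open>
  Duality between lower energy bounds and interpolation. Let \<open>p\<close> be the component of the character at \<open>x0\<close>
  orthogonal to the characters at the other nodes. It has \<open>x0\<close>-coefficient \<open>1\<close>, so its energy \<open>\<rho>\<close> is at
  least \<open>\<Lambda>\<close>, and pairing with \<open>p / \<rho>\<close> is the required interpolating polynomial. Its coefficient sum
  is controlled by the Cauchy-Schwarz inequality.
\<close>

lemma trigonometric_interpolation:
  fixes Z :: "(real ^ 'd) set" and W :: "real ^ 'd \<Rightarrow> real"
  assumes "finite A" and W: "\<And>n. n \<in> A \<Longrightarrow> 0 \<le> W n" and "finite Z" "x0 \<in> Z" "\<Lambda> > 0"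
    and lower: "\<And>u. \<Lambda> * (\<Sum>z\<in>Z. (cmod (u z))\<^sup>2) \<le> (\<Sum>n\<in>A. W n * (cmod (fourier_op Z u n))\<^sup>2)"
  shows "\<exists>c. (\<Sum>n\<in>A. c n * fourier_matrix n x0) = 1 \<and>
    (\<forall>y\<in>Z - {x0}. (\<Sum>n\<in>A. c n * fourier_matrix n y) = 0) \<and>
    (\<Sum>n\<in>A. cmod (c n)) \<le> sqrt ((\<Sum>n\<in>A. W n) / \<Lambda>)"
proof -
  obtain a where a: "\<forall>y\<in>Z - {x0}. (\<Sum>n\<in>A. W n * (fourier_matrix n x0 - (\<Sum>z\<in>Z - {x0}. a z * fourier_matrix n z)) * cnj (fourier_matrix n y)) = 0"
    using exists_orthogonal_residual[where A = A and W = W and Y = "Z - {x0}" and f = "\<lambda>n. fourier_matrix n x0" and v = "\<lambda>z n. fourier_matrix n z"] assms(1,3) W by auto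
  \<comment> \<open>Coefficients of the residual \<open>p\<close> with respect to the characters at the nodes.\<close>
  define u where "u z = (if z = x0 then 1 else - a z)" for z
  define p where "p = fourier_op Z u"
  have p_eq: "p n = fourier_matrix n x0 - (\<Sum>z\<in>Z - {x0}. a z * fourier_matrix n z)" for n
  proof -
    have "p n = u x0 * fourier_matrix n x0 + (\<Sum>z\<in>Z - {x0}. u z * fourier_matrix n z)"
      unfolding p_def fourier_op_eq using assms by (subst sum.remove[of _ x0]) auto
    also have "(\<Sum>z\<in>Z - {x0}. u z * fourier_matrix n z) = - (\<Sum>z\<in>Z - {x0}. a z * fourier_matrix n z)"
      unfolding sum_negf[symmetric] by (intro sum.cong) (auto simp: u_def)
    finally show ?thesis by (simp add: u_def)
  qed
  define \<rho> where "\<rho> = (\<Sum>n\<in>A. W n * (cmod (p n))\<^sup>2)"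
  define c where "c n = W n * cnj (p n) / \<rho>" for n
  have "1 \<le> (\<Sum>z\<in>Z. (cmod (u z))\<^sup>2)"
    using member_le_sum[of x0 Z "\<lambda>z. (cmod (u z))\<^sup>2"] assms by (simp add: u_def)
  then have "\<Lambda> \<le> \<Lambda> * (\<Sum>z\<in>Z. (cmod (u z))\<^sup>2)" using assms(5) by simp
  then have \<rho>: "\<Lambda> \<le> \<rho>" using lower[of u] by (simp add: \<rho>_def p_def)
  then have "\<rho> > 0" using assms(5) by simp
  have orth: "(\<Sum>n\<in>A. W n * p n * cnj (fourier_matrix n y)) = 0" if "y \<in> Z - {x0}" for y
    using a that by (simp add: p_eq)
  have c_eq: "(\<Sum>n\<in>A. c n * fourier_matrix n y) = cnj (\<Sum>n\<in>A. W n * p n * cnj (fourier_matrix n y)) / \<rho>" for y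
    by (simp add: c_def sum_divide_distrib)
  have "of_real \<rho> = (\<Sum>n\<in>A. W n * p n * cnj (p n))"
    by (simp only: \<rho>_def of_real_sum of_real_mult complex_norm_square mult.assoc)
  also have "\<dots> = (\<Sum>n\<in>A. \<Sum>z\<in>Z. cnj (u z) * (W n * p n * cnj (fourier_matrix n z)))"
    by (subst (2) p_def) (simp add: fourier_op_eq sum_distrib_left mult_ac)
  also have "\<dots> = (\<Sum>z\<in>Z. cnj (u z) * (\<Sum>n\<in>A. W n * p n * cnj (fourier_matrix n z)))"
    by (subst sum.swap) (simp add: sum_distrib_left)
  also have "\<dots> = (\<Sum>n\<in>A. W n * p n * cnj (fourier_matrix n x0))"
    using assms orth by (subst sum.remove[of _ x0]) (auto simp: u_def)
  finally have "(\<Sum>n\<in>A. W n * p n * cnj (fourier_matrix n x0)) = of_real \<rho>" ..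
  then have "(\<Sum>n\<in>A. c n * fourier_matrix n x0) = 1" unfolding c_eq using \<open>\<rho> > 0\<close> by simp
  moreover have "\<forall>y\<in>Z - {x0}. (\<Sum>n\<in>A. c n * fourier_matrix n y) = 0"
    unfolding c_eq using orth by simp
  moreover have "(\<Sum>n\<in>A. cmod (c n)) \<le> sqrt ((\<Sum>n\<in>A. W n) / \<Lambda>)"
  proof -
    have "(\<Sum>n\<in>A. W n * cmod (p n))\<^sup>2 = (\<Sum>n\<in>A. sqrt (W n) * (sqrt (W n) * cmod (p n)))\<^sup>2"
      using W by (simp add: mult.assoc[symmetric] cong: sum.cong)
    also have "\<dots> \<le> (\<Sum>n\<in>A. (sqrt (W n))\<^sup>2) * (\<Sum>n\<in>A. (sqrt (W n) * cmod (p n))\<^sup>2)"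
      by (rule Cauchy_Schwarz_ineq_sum)
    also have "\<dots> = (\<Sum>n\<in>A. W n) * \<rho>"
      using W by (simp add: power_mult_distrib \<rho>_def cong: sum.cong)
    finally have cs: "(\<Sum>n\<in>A. W n * cmod (p n))\<^sup>2 \<le> (\<Sum>n\<in>A. W n) * \<rho>" .
    have "(\<Sum>n\<in>A. cmod (c n)) = (\<Sum>n\<in>A. W n * cmod (p n)) / \<rho>"
      using W \<open>\<rho> > 0\<close> by (simp add: c_def norm_mult norm_divide sum_divide_distrib)
    then have "(\<Sum>n\<in>A. cmod (c n))\<^sup>2 = (\<Sum>n\<in>A. W n * cmod (p n))\<^sup>2 / \<rho>\<^sup>2" by (simp add: power_divide)
    also have "\<dots> \<le> (\<Sum>n\<in>A. W n) * \<rho> / \<rho>\<^sup>2" using cs by (intro divide_right_mono) auto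
    also have "\<dots> = (\<Sum>n\<in>A. W n) / \<rho>" using \<open>\<rho> > 0\<close> by (simp add: power2_eq_square)
    also have "\<dots> \<le> (\<Sum>n\<in>A. W n) / \<Lambda>" using \<rho> assms(5) W by (intro divide_left_mono sum_nonneg) auto
    finally show ?thesis by (rule real_le_rsqrt)
  qed
  ultimately show ?thesis by blast
qed

text \<open>
  Multiplying the node coefficients by \<open>g\<close> costs a factor \<open>B\<close> and shrinks the set of frequencies from \<open>\<Omega>'\<close>
  to \<open>\<Omega>\<close>. Stated for operators rather than for polynomials, the notion composes without computing the
  coefficients of products.
\<close>

definition multiplier ::
  "(real ^ 'd) set \<Rightarrow> (real ^ 'd) set \<Rightarrow> (real ^ 'd) set \<Rightarrow> real \<Rightarrow> (real ^ 'd \<Rightarrow> complex) \<Rightarrow> bool" where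
  "multiplier X \<Omega> \<Omega>' B g \<longleftrightarrow>
    (\<forall>u. l2_norm \<Omega> (fourier_op X (\<lambda>x. g x * u x)) \<le> B * l2_norm \<Omega>' (fourier_op X u))"

lemma l2_norm_L2_set: "l2_norm A f = L2_set (\<lambda>a. cmod (f a)) A"
  by (simp add: l2_norm_def L2_set_def)

lemma l2_norm_nonneg: "0 \<le> l2_norm A f"
  by (simp add: l2_norm_def sum_nonneg)

lemma l2_norm_sum_le: "l2_norm \<Omega> (\<lambda>\<omega>. \<Sum>\<eta>\<in>A. f \<eta> \<omega>) \<le> (\<Sum>\<eta>\<in>A. l2_norm \<Omega> (f \<eta>))"
proof (induction A rule: infinite_finite_induct)
  case (insert a A)
  have "l2_norm \<Omega> (\<lambda>\<omega>. \<Sum>\<eta>\<in>insert a A. f \<eta> \<omega>) \<le> L2_set (\<lambda>\<omega>. cmod (f a \<omega>) + cmod (\<Sum>\<eta>\<in>A. f \<eta> \<omega>)) \<Omega>"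
    unfolding l2_norm_L2_set using insert.hyps by (intro L2_set_mono) (auto intro: norm_triangle_ineq)
  also have "\<dots> \<le> l2_norm \<Omega> (f a) + l2_norm \<Omega> (\<lambda>\<omega>. \<Sum>\<eta>\<in>A. f \<eta> \<omega>)"
    unfolding l2_norm_L2_set by (rule L2_set_triangle_ineq)
  finally show ?case using insert by simp
qed (simp_all add: l2_norm_def)

text \<open>
  Multiplication by a character shifts the frequency, so this is the triangle inequality over the shifts.
\<close>

lemma multiplier_trigonometric:
  assumes "finite \<Omega>'" and shift: "\<And>\<omega> \<eta>. \<omega> \<in> \<Omega> \<Longrightarrow> \<eta> \<in> A \<Longrightarrow> \<omega> + \<eta> \<in> \<Omega>'"
    and g: "\<And>x. x \<in> X \<Longrightarrow> g x = (\<Sum>\<eta>\<in>A. c \<eta> * fourier_matrix \<eta> x)"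
    and B: "(\<Sum>\<eta>\<in>A. cmod (c \<eta>)) \<le> B"
  shows "multiplier X \<Omega> \<Omega>' B g"
  unfolding multiplier_def
proof
  fix u
  have shifted: "fourier_op X (\<lambda>x. g x * u x) \<omega> = (\<Sum>\<eta>\<in>A. c \<eta> * fourier_op X u (\<omega> + \<eta>))" for \<omega>
  proof -
    have "fourier_op X (\<lambda>x. g x * u x) \<omega> = (\<Sum>x\<in>X. \<Sum>\<eta>\<in>A. c \<eta> * (u x * fourier_matrix (\<omega> + \<eta>) x))"
      unfolding fourier_op_eq using g
      by (intro sum.cong) (auto simp: sum_distrib_left sum_distrib_right fourier_matrix_add_left mult_ac)
    then show ?thesis by (subst (asm) sum.swap) (simp add: fourier_op_eq sum_distrib_left)
  qed
  have "l2_norm \<Omega> (fourier_op X (\<lambda>x. g x * u x)) \<le> (\<Sum>\<eta>\<in>A. l2_norm \<Omega> (\<lambda>\<omega>. c \<eta> * fourier_op X u (\<omega> + \<eta>)))"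
    unfolding shifted[abs_def] by (rule l2_norm_sum_le)
  also have "\<dots> \<le> (\<Sum>\<eta>\<in>A. cmod (c \<eta>) * l2_norm \<Omega>' (fourier_op X u))"
  proof (rule sum_mono)
    fix \<eta> assume \<eta>: "\<eta> \<in> A"
    have "l2_norm \<Omega> (\<lambda>\<omega>. c \<eta> * fourier_op X u (\<omega> + \<eta>)) = cmod (c \<eta>) * l2_norm \<Omega> (\<lambda>\<omega>. fourier_op X u (\<omega> + \<eta>))"
      by (simp add: l2_norm_def norm_mult power_mult_distrib sum_distrib_left[symmetric] real_sqrt_mult)
    also have "l2_norm \<Omega> (\<lambda>\<omega>. fourier_op X u (\<omega> + \<eta>)) = l2_norm ((\<lambda>\<omega>. \<omega> + \<eta>) ` \<Omega>) (fourier_op X u)"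
      by (simp add: l2_norm_def sum.reindex)
    also have "\<dots> \<le> l2_norm \<Omega>' (fourier_op X u)"
      unfolding l2_norm_def using shift \<eta> assms(1) by (intro real_sqrt_le_mono sum_mono2) auto
    finally show "l2_norm \<Omega> (\<lambda>\<omega>. c \<eta> * fourier_op X u (\<omega> + \<eta>)) \<le> cmod (c \<eta>) * l2_norm \<Omega>' (fourier_op X u)"
      by (simp add: mult_left_mono)
  qed
  also have "\<dots> \<le> B * l2_norm \<Omega>' (fourier_op X u)"
    unfolding sum_distrib_right[symmetric] using B by (intro mult_right_mono l2_norm_nonneg)
  finally show "l2_norm \<Omega> (fourier_op X (\<lambda>x. g x * u x)) \<le> B * l2_norm \<Omega>' (fourier_op X u)" .
qed

lemma multiplier_mult:
  assumes "multiplier X \<Omega> \<Omega>' B g" "multiplier X \<Omega>' \<Omega>'' B' h" "B \<ge> 0"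
  shows "multiplier X \<Omega> \<Omega>'' (B * B') (\<lambda>x. g x * h x)"
  unfolding multiplier_def
proof
  fix u
  have "l2_norm \<Omega> (fourier_op X (\<lambda>x. g x * (h x * u x))) \<le> B * l2_norm \<Omega>' (fourier_op X (\<lambda>x. h x * u x))"
    using assms(1) by (simp add: multiplier_def)
  also have "\<dots> \<le> B * (B' * l2_norm \<Omega>'' (fourier_op X u))"
    using assms(2,3) by (intro mult_left_mono) (auto simp: multiplier_def)
  finally show "l2_norm \<Omega> (fourier_op X (\<lambda>x. g x * h x * u x)) \<le> B * B' * l2_norm \<Omega>'' (fourier_op X u)"
    by (simp add: mult.assoc)
qed

section \<open>Separated sets\<close>

lemma half_bandwidth_lower_bound:
  fixes \<beta> \<tau> M :: real
  assumes "d \<ge> 2" "\<beta> \<ge> 1 / (2 * ln 2)" "0 < \<tau>" "\<tau> \<le> 1 / (4 * real d)" "\<beta> * real d \<le> M * \<tau>"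
  shows "18/25 \<le> \<beta>" "11 \<le> M"
proof -
  have "1 / (2 * (25/36)) \<le> 1 / (2 * ln 2 :: real)"
    using ln2_le_25_over_36 by (intro frac_le) auto
  then show \<beta>: "18/25 \<le> \<beta>" using assms(2) by simp
  have d: "real d \<ge> 2" using assms(1) by simp
  have "0 < \<beta> * real d" using \<beta> d by simp
  then have "0 < M * \<tau>" using assms(5) by linarith
  then have "M \<ge> 0" using zero_less_mult_pos2 assms(3) less_imp_le by blast
  have "18/25 * real d \<le> \<beta> * real d" using \<beta> by (intro mult_right_mono) auto
  also have "\<dots> \<le> M * \<tau>" by (rule assms)
  also have "\<dots> \<le> M * (1 / (4 * real d))" using \<open>M \<ge> 0\<close> assms(4) by (intro mult_left_mono)
  finally have "18/25 * real d * (4 * real d) \<le> M" using d by (simp add: field_simps)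
  moreover have "2 * 2 \<le> real d * real d" using d by (intro mult_mono) auto
  ultimately show "11 \<le> M" by simp
qed

text \<open>
  With \<open>a = \<beta> d\<close> and \<open>M \<tau> \<ge> a\<close> the added fraction is at most \<open>1 / (2 a)\<close>, and
  \<open>(1 + 1 / (2 \<beta> d)) ^ d \<le> exp (1 / (2 \<beta>))\<close>. After clearing \<open>\<tau>\<^sup>2\<close> the numerator is about \<open>10 / pi\<^sup>2\<close> and
  the denominator about \<open>2 a\<^sup>2\<close>; the assumptions force \<open>a \<ge> 36/25\<close> and \<open>\<tau> \<le> 1/8\<close>, which leaves enough room for
  the lower order terms.
\<close>

lemma packing_constant_le:
  fixes \<beta> \<tau> M :: real
  assumes "d \<ge> 2" "\<beta> \<ge> 1 / (2 * ln 2)" "0 < \<tau>" "\<tau> \<le> 1 / (4 * real d)" "\<beta> * real d \<le> M * \<tau>"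
  shows "(1 + (10 / (pi\<^sup>2 * \<tau>\<^sup>2) + (1 / \<tau> + 1)) / of_int ((2 * \<lfloor>M\<rfloor> + 1) * (2 * \<lfloor>M / 2\<rfloor> + 1))) ^ d
    \<le> exp (1 / (2 * \<beta>))"
proof -
  note \<beta>M = half_bandwidth_lower_bound[OF assms]
  define a where "a = \<beta> * real d"
  define D where "D = real_of_int ((2 * \<lfloor>M\<rfloor> + 1) * (2 * \<lfloor>M / 2\<rfloor> + 1))"
  have d: "real d \<ge> 2" using assms(1) by simp
  have "18/25 * 2 \<le> \<beta> * real d" using \<beta>M d by (intro mult_mono) auto
  then have a: "36/25 \<le> a" by (simp add: a_def)
  have \<tau>8: "\<tau> \<le> 1/8" using assms(4) d by (smt (verit) frac_le)
  have "(2 * M - 1) * (M - 1) \<le> D"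
    unfolding D_def of_int_mult using \<beta>M by (intro mult_mono) (auto, linarith+)
  then have "\<tau>\<^sup>2 * ((2 * M - 1) * (M - 1)) \<le> \<tau>\<^sup>2 * D" by (intro mult_left_mono) auto
  moreover have "\<tau>\<^sup>2 * ((2 * M - 1) * (M - 1)) = (2 * (M * \<tau>) - \<tau>) * (M * \<tau> - \<tau>)"
    by (simp add: power2_eq_square algebra_simps)
  moreover have "(2 * a - \<tau>) * (a - \<tau>) \<le> (2 * (M * \<tau>) - \<tau>) * (M * \<tau> - \<tau>)"
    using assms(5) a \<tau>8 unfolding a_def[symmetric] by (intro mult_mono) auto
  moreover have "2 * a * (5/4) \<le> (2 * a - \<tau>) * (a - \<tau>)"
  proof -
    have "a * (3 * \<tau>) \<le> a * (3/8)" using \<tau>8 a by (intro mult_left_mono) auto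
    moreover have "a * (36/25) \<le> a * a" using a by (intro mult_left_mono) auto
    ultimately have "2 * a * (5/4) \<le> 2 * (a * a) - a * (3 * \<tau>) + \<tau> * \<tau>"
      using a zero_le_square[of \<tau>] by linarith
    then show ?thesis by (simp add: algebra_simps)
  qed
  ultimately have D: "2 * a * (5/4) \<le> \<tau>\<^sup>2 * D" by linarith
  have "(313/100)^2 \<le> pi^2" using pi_approx by (intro power_mono) auto
  then have "10 / pi\<^sup>2 \<le> 10 / (313/100)^2" by (intro frac_le) auto
  then have pi2: "10 / pi\<^sup>2 \<le> 21/20" by (simp add: power2_eq_square)
  have "\<tau>\<^sup>2 \<le> (1/8)^2" using \<tau>8 assms(3) by (intro power_mono) auto
  then have num: "10 / pi\<^sup>2 + \<tau> + \<tau>\<^sup>2 \<le> 5/4" using pi2 \<tau>8 by (simp add: power2_eq_square)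
  have "0 < \<tau>\<^sup>2 * D" using D a by linarith
  then have "0 < D" using zero_less_mult_pos assms(3) by (metis zero_less_power)
  have "(10 / (pi\<^sup>2 * \<tau>\<^sup>2) + (1 / \<tau> + 1)) / D = (10 / pi\<^sup>2 + \<tau> + \<tau>\<^sup>2) / (\<tau>\<^sup>2 * D)"
    using assms(3) \<open>0 < D\<close> by (simp add: field_simps power2_eq_square)
  also have "\<dots> \<le> (5/4) / (2 * a * (5/4))"
    using num D a assms(3) by (intro frac_le) auto
  also have "\<dots> = 1 / (2 * \<beta>) / real d" by (simp add: a_def)
  finally have "1 + (10 / (pi\<^sup>2 * \<tau>\<^sup>2) + (1 / \<tau> + 1)) / D \<le> exp (1 / (2 * \<beta>) / real d)"
    using exp_ge_add_one_self[of "1 / (2 * \<beta>) / real d"] by linarith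
  then have "(1 + (10 / (pi\<^sup>2 * \<tau>\<^sup>2) + (1 / \<tau> + 1)) / D) ^ d \<le> exp (1 / (2 * \<beta>) / real d) ^ d"
    using assms(3) \<open>0 < D\<close> by (intro power_mono) auto
  also have "\<dots> = exp (1 / (2 * \<beta>))" using d by (simp add: exp_of_nat_mult[symmetric])
  finally show ?thesis by (simp only: D_def)
qed

lemma int_box_add: "\<omega> \<in> int_box lo hi \<Longrightarrow> \<eta> \<in> int_box a b \<Longrightarrow> \<omega> + \<eta> \<in> int_box (lo + a) (hi + b)"
  by (auto simp: int_box_def int_lattice_def intro: add_mono)

definition separated :: "real \<Rightarrow> (real ^ 'd) set \<Rightarrow> bool" where
  "separated \<tau> Z \<longleftrightarrow> (\<forall>z\<in>Z. \<forall>z'\<in>Z. z \<noteq> z' \<longrightarrow> \<tau> < torus_lp_norm \<infinity> (z - z'))"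

text \<open>
  The constant \<open>2 - exp (1 / (2 \<beta>))\<close> is one minus the relative off-diagonal mass
  \<open>exp (1 / (2 \<beta>)) - 1\<close> of the Gram matrix.
\<close>

lemma separated_energy:
  fixes Z :: "(real ^ 'd) set" and \<beta> \<tau> M :: real
  assumes "CARD('d) \<ge> 2" "\<beta> \<ge> 1 / (2 * ln 2)" "0 < \<tau>" "\<tau> \<le> 1 / (4 * real CARD('d))"
    "\<beta> * real CARD('d) \<le> M * \<tau>"
    and P: "P = \<lfloor>M\<rfloor>" and q: "q = \<lfloor>M / 2\<rfloor>" and Z: "finite Z" "separated \<tau> Z"
  shows "of_int (2 * P + 1) ^ CARD('d) * (2 - exp (1 / (2 * \<beta>))) * (\<Sum>z\<in>Z. (cmod (u z))\<^sup>2) \<le>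
    (\<Sum>n\<in>int_box (-(P+q)) (P+q). trapezoid_weight P q n * (cmod (fourier_op Z u n))\<^sup>2)"
proof -
  define T where "T = real_of_int (2 * P + 1) ^ CARD('d)"
  have "11 \<le> M" by (rule half_bandwidth_lower_bound[OF assms(1-5)])
  then have Pq: "P \<ge> 0" "q \<ge> 0" by (simp_all add: P q)
  have T: "0 \<le> T" using Pq by (simp add: T_def)
  have off: "(\<Sum>z'\<in>Z - {z}. cmod (\<Sum>n\<in>int_box (-(P+q)) (P+q). trapezoid_weight P q n * fourier_matrix n (z' - z)))
      \<le> T * (exp (1 / (2 * \<beta>)) - 1)" if "z \<in> Z" for z
  proof -
    have "(\<Sum>z'\<in>Z - {z}. cmod (\<Sum>n\<in>int_box (-(P+q)) (P+q). trapezoid_weight P q n * fourier_matrix n (z' - z)))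
      \<le> T * ((1 + (10 / (pi\<^sup>2 * \<tau>\<^sup>2) + (1 / \<tau> + 1)) / of_int ((2 * P + 1) * (2 * q + 1))) ^ CARD('d) - 1)"
      unfolding T_def using Z that by (intro cell_packing Pq assms) (auto simp: separated_def)
    also have "\<dots> \<le> T * (exp (1 / (2 * \<beta>)) - 1)"
      using packing_constant_le[OF assms(1-5)] T unfolding P q by (intro mult_left_mono diff_right_mono)
    finally show ?thesis .
  qed
  have "((\<Sum>n\<in>(int_box (-(P+q)) (P+q) :: (real ^ 'd) set). trapezoid_weight P q n) - T * (exp (1 / (2 * \<beta>)) - 1)) * (\<Sum>z\<in>Z. (cmod (u z))\<^sup>2)
    \<le> (\<Sum>n\<in>int_box (-(P+q)) (P+q). trapezoid_weight P q n * (cmod (fourier_op Z u n))\<^sup>2)"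
    by (rule weighted_energy_lower_bound[OF Z(1) off])
  moreover have "(\<Sum>n\<in>(int_box (-(P+q)) (P+q) :: (real ^ 'd) set). trapezoid_weight P q n) = T"
    unfolding T_def by (rule sum_trapezoid_weight[OF Pq])
  ultimately show ?thesis unfolding T_def[symmetric] by (simp add: algebra_simps)
qed

lemma separated_l2_norm:
  fixes Z :: "(real ^ 'd) set" and \<beta> \<tau> M :: real
  assumes "CARD('d) \<ge> 2" "\<beta> \<ge> 1 / (2 * ln 2)" "0 < \<tau>" "\<tau> \<le> 1 / (4 * real CARD('d))"
    "\<beta> * real CARD('d) \<le> M * \<tau>"
    and P: "P = \<lfloor>M\<rfloor>" and q: "q = \<lfloor>M / 2\<rfloor>" and Z: "finite Z" "separated \<tau> Z"
  shows "of_int (2 * P + 1) ^ CARD('d) * (2 - exp (1 / (2 * \<beta>))) * (\<Sum>z\<in>Z. (cmod (u z))\<^sup>2) \<le>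
    (l2_norm (int_box (-(P+q)) (P+q)) (fourier_op Z u))\<^sup>2"
proof -
  have "11 \<le> M" by (rule half_bandwidth_lower_bound[OF assms(1-5)])
  then have "q \<ge> 0" by (simp add: q)
  then have "(\<Sum>n\<in>int_box (-(P+q)) (P+q). trapezoid_weight P q n * (cmod (fourier_op Z u n))\<^sup>2)
     \<le> (\<Sum>n\<in>int_box (-(P+q)) (P+q). (cmod (fourier_op Z u n))\<^sup>2)"
    by (intro sum_mono mult_left_le_one_le trapezoid_weight_bounds) auto
  then show ?thesis
    using separated_energy[OF assms, of u] by (simp add: l2_norm_def sum_nonneg)
qed

text \<open>
  The weight enters the interpolation cost only through the quotient of its total mass and the energy bound, in which
  the mass \<open>(2 P + 1)\<^sup>d\<close> cancels.
\<close>

lemma separated_multiplier: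
  fixes Z :: "(real ^ 'd) set" and \<beta> \<tau> M :: real
  assumes "CARD('d) \<ge> 2" "\<beta> \<ge> 1 / (2 * ln 2)" "0 < \<tau>" "\<tau> \<le> 1 / (4 * real CARD('d))"
    "\<beta> * real CARD('d) \<le> M * \<tau>"
    and P: "P = \<lfloor>M\<rfloor>" and q: "q = \<lfloor>M / 2\<rfloor>" and Z: "finite Z" "separated \<tau> Z"
    and "x0 \<in> Z" and pos: "exp (1 / (2 * \<beta>)) < 2"
  shows "\<exists>h. h x0 = 1 \<and> (\<forall>y\<in>Z - {x0}. h y = 0) \<and>
    multiplier X (int_box lo hi) (int_box (lo - (P + q)) (hi + (P + q))) (1 / sqrt (2 - exp (1 / (2 * \<beta>)))) h"
proof -
  define A where "A = (int_box (-(P+q)) (P+q) :: (real ^ 'd) set)"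
  define T where "T = real_of_int (2 * P + 1) ^ CARD('d)"
  have "11 \<le> M" by (rule half_bandwidth_lower_bound[OF assms(1-5)])
  then have Pq: "P \<ge> 0" "q \<ge> 0" by (simp_all add: P q)
  have T: "0 < T" using Pq by (simp add: T_def)
  have "\<exists>c. (\<Sum>n\<in>A. c n * fourier_matrix n x0) = 1 \<and>
    (\<forall>y\<in>Z - {x0}. (\<Sum>n\<in>A. c n * fourier_matrix n y) = 0) \<and>
    (\<Sum>n\<in>A. cmod (c n)) \<le> sqrt ((\<Sum>n\<in>A. trapezoid_weight P q n) / (T * (2 - exp (1 / (2 * \<beta>)))))"
    using separated_energy[OF assms(1-9)] trapezoid_weight_bounds[OF Pq(2)] T pos Z \<open>x0 \<in> Z\<close>
    by (intro trigonometric_interpolation) (auto simp: A_def T_def)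
  then obtain c where c: "(\<Sum>n\<in>A. c n * fourier_matrix n x0) = 1"
    "\<forall>y\<in>Z - {x0}. (\<Sum>n\<in>A. c n * fourier_matrix n y) = 0"
    "(\<Sum>n\<in>A. cmod (c n)) \<le> sqrt ((\<Sum>n\<in>A. trapezoid_weight P q n) / (T * (2 - exp (1 / (2 * \<beta>)))))"
    by blast
  have "(\<Sum>n\<in>A. trapezoid_weight P q n) = T"
    unfolding A_def T_def by (rule sum_trapezoid_weight[OF Pq])
  then have "(\<Sum>n\<in>A. cmod (c n)) \<le> 1 / sqrt (2 - exp (1 / (2 * \<beta>)))"
    using c(3) T by (simp add: real_sqrt_divide)
  then have "multiplier X (int_box lo hi) (int_box (lo - (P + q)) (hi + (P + q))) (1 / sqrt (2 - exp (1 / (2 * \<beta>))))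
    (\<lambda>x. \<Sum>n\<in>A. c n * fourier_matrix n x)"
    using int_box_add[of _ lo hi _ "-(P+q)" "P+q"]
    by (intro multiplier_trigonometric[where A = A and c = c]) (auto simp: A_def algebra_simps)
  then show ?thesis using c(1,2) by (intro exI[of _ "\<lambda>x. \<Sum>n\<in>A. c n * fourier_matrix n x"]) simp
qed

lemma separated_family_multiplier:
  fixes Z :: "nat \<Rightarrow> (real ^ 'd) set" and \<beta> \<tau> M :: real
  assumes "CARD('d) \<ge> 2" "\<beta> \<ge> 1 / (2 * ln 2)" "0 < \<tau>" "\<tau> \<le> 1 / (4 * real CARD('d))"
    "\<beta> * real CARD('d) \<le> M * \<tau>"
    and P: "P = \<lfloor>M\<rfloor>" and q: "q = \<lfloor>M / 2\<rfloor>"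
    and Z: "\<And>j. j < J \<Longrightarrow> finite (Z j) \<and> separated \<tau> (Z j) \<and> x0 \<in> Z j"
    and pos: "exp (1 / (2 * \<beta>)) < 2"
  shows "\<exists>h. h x0 = 1 \<and> (\<forall>j<J. \<forall>y\<in>Z j - {x0}. h y = 0) \<and>
    multiplier X (int_box lo hi) (int_box (lo - int J * (P + q)) (hi + int J * (P + q)))
      ((1 / sqrt (2 - exp (1 / (2 * \<beta>)))) ^ J) h"
  using Z
proof (induction J)
  case 0
  then show ?case by (intro exI[of _ "\<lambda>_. 1"]) (simp add: multiplier_def)
next
  case (Suc J)
  obtain h where h: "h x0 = 1" "\<forall>j<J. \<forall>y\<in>Z j - {x0}. h y = 0"
    "multiplier X (int_box lo hi) (int_box (lo - int J * (P + q)) (hi + int J * (P + q)))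
      ((1 / sqrt (2 - exp (1 / (2 * \<beta>)))) ^ J) h"
    using Suc by auto
  obtain h' where h': "h' x0 = 1" "\<forall>y\<in>Z J - {x0}. h' y = 0"
    "multiplier X (int_box (lo - int J * (P + q)) (hi + int J * (P + q)))
      (int_box (lo - int J * (P + q) - (P + q)) (hi + int J * (P + q) + (P + q))) (1 / sqrt (2 - exp (1 / (2 * \<beta>)))) h'"
    using separated_multiplier[OF assms(1-7), of "Z J" x0] Suc.prems[of J] pos by blast
  have "multiplier X (int_box lo hi) (int_box (lo - int J * (P + q) - (P + q)) (hi + int J * (P + q) + (P + q)))
     ((1 / sqrt (2 - exp (1 / (2 * \<beta>)))) ^ J * (1 / sqrt (2 - exp (1 / (2 * \<beta>))))) (\<lambda>x. h x * h' x)"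
    using pos by (intro multiplier_mult[OF h(3) h'(3)]) simp
  moreover have "lo - int J * (P + q) - (P + q) = lo - int (Suc J) * (P + q)"
    "hi + int J * (P + q) + (P + q) = hi + int (Suc J) * (P + q)" by (simp_all add: algebra_simps)
  ultimately have "multiplier X (int_box lo hi) (int_box (lo - int (Suc J) * (P + q)) (hi + int (Suc J) * (P + q)))
     ((1 / sqrt (2 - exp (1 / (2 * \<beta>)))) ^ Suc J) (\<lambda>x. h x * h' x)"
    by (simp only: power_Suc2)
  then show ?case
    using h h' by (intro exI[of _ "\<lambda>x. h x * h' x"]) (auto simp: less_Suc_eq)
qed

section \<open>Killing single nodes\<close>

text \<open>
  For small \<open>z\<close> the largest multiple \<open>N\<close> is best and the sine is nearly linear. Otherwise, as
  \<open>z \<le> 1/4\<close>, some multiple of \<open>z\<close> lies in \<open>[1/4, 1/2]\<close>, where the sine is at least \<open>sqrt 2 / 2\<close>.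
\<close>

lemma exists_frequency:
  fixes M \<delta> z :: real and N :: nat
  assumes "0 < \<delta>" "\<delta> \<le> z" "z \<le> 1/4" "0 \<le> M" "2 * M * \<delta> \<le> 1" "2 * M \<le> 3 * real N" "N \<ge> 1"
  shows "\<exists>N'\<in>{1..N}. sqrt 2 * M * \<delta> \<le> \<bar>sin (pi * (real N' * z))\<bar>"
proof (cases "real N * z \<le> 1/4")
  case True
  define y where "y = pi * (real N * z)"
  have "0 < z" using assms by simp
  have y0: "0 < y" using assms \<open>0 < z\<close> by (simp add: y_def)
  have "y \<le> pi * (1/4)" unfolding y_def using True by (intro mult_left_mono) auto
  then have y1: "y \<le> pi / 4" by simp
  then have "y \<le> 1" using pi_approx by simp
  have "0 < sin y" using y0 y1 by (intro sin_gt_zero) auto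
  have "1 \<le> 1 / y^2" using y0 \<open>y \<le> 1\<close> by (simp add: power_le_one)
  have "1 / (sin y)^2 \<le> 1 / y^2 + 1" using y0 y1 by (intro inverse_sin_square_le) auto
  also have "1 / y^2 + 1 \<le> 1 / y^2 + 1 / y^2" using \<open>1 \<le> 1 / y^2\<close> by (rule add_left_mono)
  finally have "1 / (sin y)^2 \<le> 1 / y^2 + 1 / y^2" .
  then have "1 / (sin y)^2 \<le> 2 / y^2" by (simp only: add_divide_distrib[symmetric] one_add_one)
  then have "y^2 \<le> 2 * (sin y)^2" using y0 \<open>0 < sin y\<close> by (simp add: field_simps)
  then have "y \<le> sqrt (2 * (sin y)^2)" by (rule real_le_rsqrt)
  then have y2: "y \<le> sqrt 2 * sin y" using \<open>0 < sin y\<close> by (simp add: real_sqrt_mult)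
  have "2 * (M * \<delta>) \<le> 2 * (M * z)" using assms by (intro mult_left_mono) auto
  also have "\<dots> \<le> 3 * (real N * z)" using assms \<open>0 < z\<close> mult_right_mono[of "2*M" "3 * real N" z] by simp
  also have "\<dots> \<le> y" unfolding y_def using pi_approx \<open>0 < z\<close> by (intro mult_right_mono) auto
  finally have "2 * (M * \<delta>) \<le> sqrt 2 * sin y" using y2 by simp
  then have "sqrt 2 * (sqrt 2 * M * \<delta>) \<le> sqrt 2 * sin y" by (simp add: mult.assoc[symmetric])
  then have "sqrt 2 * M * \<delta> \<le> sin y" by (rule mult_left_le_imp_le) simp
  then show ?thesis using assms(7) \<open>0 < sin y\<close> by (intro bexI[of _ N]) (auto simp: y_def)
next
  case False
  define N' where "N' = nat \<lceil>1 / (4 * z)\<rceil>"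
  have "0 < z" using assms by simp
  then have pos: "0 < 1 / (4 * z)" by simp
  then have N'1: "1 / (4 * z) \<le> real N'" "real N' < 1 / (4 * z) + 1"
    unfolding N'_def by linarith+
  have "1/4 \<le> real N' * z" using N'1(1) \<open>0 < z\<close> by (simp add: field_simps)
  have "real N' * z < (1 / (4 * z) + 1) * z" using N'1(2) \<open>0 < z\<close> by (intro mult_strict_right_mono)
  also have "\<dots> = 1/4 + z" using \<open>0 < z\<close> by (simp add: field_simps)
  finally have "real N' * z \<le> 1/2" using assms(3) by simp
  have "1 / (4 * z) \<le> real N" using False \<open>0 < z\<close> by (simp add: field_simps)
  then have "N' \<le> N" unfolding N'_def by (simp add: ceiling_le_iff)
  have "1 \<le> N'" using N'1 pos by linarith
  have "sin (pi / 4) \<le> sin (pi * (real N' * z))"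
  proof (rule sin_monotone_2pi_le)
    show "pi / 4 \<le> pi * (real N' * z)" using mult_left_mono[OF \<open>1/4 \<le> real N' * z\<close>, of pi] by simp
    show "pi * (real N' * z) \<le> pi / 2" using mult_left_mono[OF \<open>real N' * z \<le> 1/2\<close>, of pi] by simp
  qed (use pi_gt_zero in linarith)
  moreover have "sqrt 2 * M * \<delta> \<le> sqrt 2 / 2"
    using mult_left_mono[OF assms(5), of "sqrt 2 / 2"] by (simp add: mult_ac)
  ultimately have "sqrt 2 * M * \<delta> \<le> sin (pi * (real N' * z))" unfolding sin_45 by linarith
  then show ?thesis
    using \<open>1 \<le> N'\<close> \<open>N' \<le> N\<close> by (intro bexI[of _ N']) auto
qed

lemma int_lattice_add: "a \<in> int_lattice \<Longrightarrow> b \<in> int_lattice \<Longrightarrow> a + b \<in> int_lattice"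
  by (simp add: int_lattice_def)

text \<open>
  With \<open>n = N' sgn (x0 - y)\<close>, coordinatewise and for the torus representative of \<open>x0 - y\<close>, the phase of the
  character \<open>n\<close> at \<open>x0 - y\<close> is \<open>N'\<close> times the torus \<open>\<ell>\<^sup>1\<close> norm. An additional character \<open>k\<close>
  moves both frequencies of the factor into \<open>[0, N]\<^sup>d\<close>, so that only the upper end of the box grows.
\<close>

lemma single_node_multiplier:
  fixes x0 y :: "real ^ 'd" and M \<delta> :: real and N :: nat
  assumes "0 < \<delta>" "\<delta> \<le> torus_lp_norm 1 (x0 - y)" "torus_lp_norm 1 (x0 - y) \<le> 1/4"
    "2 * M * \<delta> \<le> 1" "2 * M \<le> 3 * real N" "N \<ge> 1" "M > 0"
  shows "\<exists>g. g x0 = 1 \<and> g y = 0 \<and>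
    multiplier X (int_box lo hi) (int_box lo (hi + int N)) (1 / (sqrt 2 * M * \<delta>)) g"
proof -
  define z where "z = torus_lp_norm 1 (x0 - y)"
  define w where "w = torus_rep (x0 - y)"
  obtain N' where N': "N' \<in> {1..N}" "sqrt 2 * M * \<delta> \<le> \<bar>sin (pi * (real N' * z))\<bar>"
    using exists_frequency[of \<delta> z M N] assms by (auto simp: z_def)
  define n :: "real ^ 'd" where "n = (\<chi> i. of_nat N' * sgn (w $ i))"
  define k :: "real ^ 'd" where "k = (\<chi> i. if w $ i < 0 then of_nat N' else 0)"
  have lattice: "n \<in> int_lattice" "k \<in> int_lattice"
    by (auto simp: n_def k_def int_lattice_def sgn_if)
  have "n $ i * w $ i = real N' * \<bar>w $ i\<bar>" for i
    by (simp add: n_def sgn_if)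
  then have nw: "n \<bullet> w = real N' * z"
    by (simp add: inner_vec_def z_def torus_lp_norm_1 w_def sum_distrib_left)
  have "0 < z" using assms by (simp add: z_def)
  then have "n \<noteq> 0" using nw N' by auto
  define s where "s = fourier_matrix n (x0 - y)"
  have "s = fourier_matrix n w" unfolding s_def w_def using lattice by (simp add: fourier_matrix_torus_rep)
  then have "s = cis (- 2 * pi * (real N' * z))" by (simp only: fourier_matrix_cis nw)
  then have "cmod (1 - s) = 2 * \<bar>sin (pi * (real N' * z))\<bar>"
    by (simp add: one_minus_cis)
  then have s: "2 * (sqrt 2 * M * \<delta>) \<le> cmod (1 - s)" using N' by simp
  have pos: "0 < sqrt 2 * M * \<delta>" using assms by simp
  have "1 - s \<noteq> 0"
  proof
    assume "1 - s = 0"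
    then have "cmod (1 - s) = 0" by simp
    then show False using s pos by linarith
  qed
  define D where "D = fourier_matrix k x0 * (1 - s)"
  have D: "D \<noteq> 0" "cmod D = cmod (1 - s)"
    using \<open>1 - s \<noteq> 0\<close> norm_fourier_matrix[of k x0] by (auto simp: D_def norm_mult simp del: norm_fourier_matrix)
  define c where "c \<eta> = (if \<eta> = k then 1 / D else - fourier_matrix n (- y) / D)" for \<eta>
  define g where "g t = fourier_matrix k t * (1 - fourier_matrix n (t - y)) / D" for t
  have "k + n \<noteq> k" using \<open>n \<noteq> 0\<close> by simp
  have g_eq: "g t = (\<Sum>\<eta>\<in>{k, k + n}. c \<eta> * fourier_matrix \<eta> t)" for t
    using \<open>n \<noteq> 0\<close> D fourier_matrix_add_right[of n t "- y"]
    by (simp add: g_def c_def fourier_matrix_add_left field_simps)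
  have "(\<Sum>\<eta>\<in>{k, k + n}. cmod (c \<eta>)) = 2 / cmod (1 - s)"
    using \<open>n \<noteq> 0\<close> D by (simp add: c_def norm_divide)
  also have "\<dots> \<le> 2 / (2 * (sqrt 2 * M * \<delta>))"
    using s pos by (intro frac_le) auto
  also have "\<dots> = 1 / (sqrt 2 * M * \<delta>)" by simp
  finally have "(\<Sum>\<eta>\<in>{k, k + n}. cmod (c \<eta>)) \<le> 1 / (sqrt 2 * M * \<delta>)" .
  moreover have "\<omega> + \<eta> \<in> int_box lo (hi + int N)" if "\<omega> \<in> int_box lo hi" "\<eta> \<in> {k, k + n}" for \<omega> \<eta> :: "real ^ 'd"
  proof -
    have "0 \<le> \<eta> $ i \<and> \<eta> $ i \<le> real N" for i
      using that(2) N' by (auto simp: k_def n_def sgn_if)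
    moreover have "\<eta> \<in> int_lattice" using that(2) lattice by (auto intro: int_lattice_add)
    ultimately have "\<eta> \<in> int_box 0 (int N)" by (simp add: int_box_def)
    then show ?thesis using int_box_add[OF that(1)] by fastforce
  qed
  ultimately have "multiplier X (int_box lo hi) (int_box lo (hi + int N)) (1 / (sqrt 2 * M * \<delta>)) g"
    using g_eq by (intro multiplier_trigonometric[where A = "{k, k + n}" and c = c]) auto
  moreover have "g x0 = 1" using D by (simp add: g_def D_def s_def)
  moreover have "g y = 0" by (simp add: g_def)
  ultimately show ?thesis by blast
qed

lemma node_set_multiplier:
  fixes x0 :: "real ^ 'd" and M \<delta> :: real and N :: nat
  assumes "finite S" "\<And>y. y \<in> S \<Longrightarrow> \<delta> \<le> torus_lp_norm 1 (x0 - y) \<and> torus_lp_norm 1 (x0 - y) \<le> 1/4"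
    "0 < \<delta>" "2 * M * \<delta> \<le> 1" "2 * M \<le> 3 * real N" "N \<ge> 1" "M > 0"
  shows "\<exists>g. g x0 = 1 \<and> (\<forall>y\<in>S. g y = 0) \<and>
    multiplier X (int_box lo hi) (int_box lo (hi + int (card S) * int N)) ((1 / (sqrt 2 * M * \<delta>)) ^ card S) g"
  using assms(1,2)
proof (induction S rule: finite_induct)
  case empty
  then show ?case by (intro exI[of _ "\<lambda>_. 1"]) (simp add: multiplier_def)
next
  case (insert y S)
  obtain g where g: "g x0 = 1" "\<forall>y\<in>S. g y = 0"
    "multiplier X (int_box lo hi) (int_box lo (hi + int (card S) * int N)) ((1 / (sqrt 2 * M * \<delta>)) ^ card S) g"
    using insert by auto
  obtain g' where g': "g' x0 = 1" "g' y = 0"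
    "multiplier X (int_box lo (hi + int (card S) * int N)) (int_box lo (hi + int (card S) * int N + int N)) (1 / (sqrt 2 * M * \<delta>)) g'"
    using single_node_multiplier[of \<delta> x0 y M N X lo "hi + int (card S) * int N"] insert.prems[of y] assms(3-7) by auto
  have "multiplier X (int_box lo hi) (int_box lo (hi + int (card S) * int N + int N))
     ((1 / (sqrt 2 * M * \<delta>)) ^ card S * (1 / (sqrt 2 * M * \<delta>))) (\<lambda>x. g x * g' x)"
    using assms by (intro multiplier_mult[OF g(3) g'(3)]) simp
  moreover have "hi + int (card S) * int N + int N = hi + int (card (insert y S)) * int N"
    using insert.hyps by (simp add: algebra_simps)
  moreover have "(1 / (sqrt 2 * M * \<delta>)) ^ card S * (1 / (sqrt 2 * M * \<delta>)) = (1 / (sqrt 2 * M * \<delta>)) ^ card (insert y S)"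
    using insert.hyps by simp
  ultimately have "multiplier X (int_box lo hi) (int_box lo (hi + int (card (insert y S)) * int N))
     ((1 / (sqrt 2 * M * \<delta>)) ^ card (insert y S)) (\<lambda>x. g x * g' x)" by simp
  then show ?case
    using g g' by (intro exI[of _ "\<lambda>x. g x * g' x"]) auto
qed

section \<open>The lower bound on the torus\<close>

lemma l2_norm_mono: "finite \<Omega>' \<Longrightarrow> \<Omega> \<subseteq> \<Omega>' \<Longrightarrow> l2_norm \<Omega> f \<le> l2_norm \<Omega>' f"
  unfolding l2_norm_def by (intro real_sqrt_le_mono sum_mono2) auto

lemma multiplier_mono:
  assumes "multiplier X \<Omega> \<Omega>' B g" "B \<le> B'" "0 \<le> B'" "finite \<Omega>''" "\<Omega>' \<subseteq> \<Omega>''"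
  shows "multiplier X \<Omega> \<Omega>'' B' g"
  unfolding multiplier_def
proof
  fix u
  have "l2_norm \<Omega> (fourier_op X (\<lambda>x. g x * u x)) \<le> B * l2_norm \<Omega>' (fourier_op X u)"
    using assms(1) by (simp add: multiplier_def)
  also have "\<dots> \<le> B' * l2_norm \<Omega>'' (fourier_op X u)"
    using assms by (intro mult_mono l2_norm_mono l2_norm_nonneg)
  finally show "l2_norm \<Omega> (fourier_op X (\<lambda>x. g x * u x)) \<le> \<dots>" .
qed

lemma int_box_mono: "lo' \<le> lo \<Longrightarrow> hi \<le> hi' \<Longrightarrow> int_box lo hi \<subseteq> int_box lo' hi'"
  unfolding int_box_def by (force intro: order_trans[of "of_int lo'" "of_int lo"] order_trans[of _ "of_int hi" "of_int hi'"])

text \<open>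
  The multipliers for \<open>S\<close> and for \<open>Z 0, ..., Z (J - 1)\<close> are composed; what is left of \<open>u\<close> lives on the separated
  set \<open>Z J\<close>, where \<open>separated_l2_norm\<close> applies. In half-widths, the \<open>J + 1\<close> separated sets use
  \<open>P + q \<le> 3 M / 2\<close> each and the \<open>J\<close> single nodes \<open>N / 2 \<le> M / 2\<close> each after centring, in
  total at most \<open>2 (J + 1) M\<close>.
\<close>

lemma node_coefficient_bound:
  fixes X S :: "(real ^ 'd) set" and Z :: "nat \<Rightarrow> (real ^ 'd) set" and \<beta> \<tau> \<delta> M :: real
  assumes num: "CARD('d) \<ge> 2" "\<beta> \<ge> 1 / (2 * ln 2)" "0 < \<tau>" "\<tau> \<le> 1 / (4 * real CARD('d))"
    "\<beta> * real CARD('d) \<le> M * \<tau>"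
    and \<delta>: "0 \<le> \<delta>" "2 * M * \<delta> \<le> 1"
    and X: "finite X" "x0 \<in> X"
    and S: "S \<subseteq> X" "card S \<le> J"
      "\<And>y. y \<in> S \<Longrightarrow> \<delta> \<le> torus_lp_norm 1 (x0 - y) \<and> torus_lp_norm 1 (x0 - y) \<le> 1/4"
    and Z: "\<And>j. j \<le> J \<Longrightarrow> Z j \<subseteq> X \<and> separated \<tau> (Z j) \<and> x0 \<in> Z j"
    and cover: "X \<subseteq> S \<union> (\<Union>j\<le>J. Z j)"
  shows "sqrt (of_int (2 * \<lfloor>M\<rfloor> + 1) ^ CARD('d) * (2 - exp (1 / (2 * \<beta>)))) * cmod (u x0) *
      (sqrt 2 * M * \<delta> * sqrt (2 - exp (1 / (2 * \<beta>)))) ^ J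
    \<le> l2_norm (cube (2 * real (J + 1) * M) \<inter> int_lattice) (fourier_op X u)" (is "_ \<le> ?l")
proof (cases "exp (1 / (2 * \<beta>)) < 2 \<and> (\<delta> > 0 \<or> J = 0)")
  case False
  \<comment> \<open>If \<open>exp (1 / (2 * \<beta>)) = 2\<close>, or if \<open>\<delta> = 0\<close> and \<open>J > 0\<close>, then the left-hand side is zero.\<close>
  have "0 < 1 / (2 * \<beta>)" "1 / (2 * \<beta>) \<le> ln 2"
  proof -
    have "0 < 1 / (2 * ln 2 :: real)" by simp
    then have "0 < \<beta>" using num(2) by linarith
    then show "0 < 1 / (2 * \<beta>)" by simp
    show "1 / (2 * \<beta>) \<le> ln 2" using num(2) \<open>0 < \<beta>\<close> by (simp add: field_simps)
  qed
  then have "exp (1 / (2 * \<beta>)) \<le> exp (ln 2)" by (simp only: exp_le_cancel_iff)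
  then have "exp (1 / (2 * \<beta>)) \<le> 2" by simp
  then have "exp (1 / (2 * \<beta>)) = 2 \<or> (\<delta> = 0 \<and> J > 0)" using False \<delta> by auto
  then show ?thesis by (auto simp: l2_norm_nonneg zero_power)
next
  case True
  define \<epsilon> where "\<epsilon> = 2 - exp (1 / (2 * \<beta>))"
  have \<epsilon>: "0 < \<epsilon>" using True by (simp add: \<epsilon>_def)
  define P where "P = \<lfloor>M\<rfloor>"
  define q where "q = \<lfloor>M / 2\<rfloor>"
  define N where "N = nat \<lfloor>M\<rfloor>"
  define T where "T = real_of_int (2 * P + 1) ^ CARD('d)"
  have "11 \<le> M" by (rule half_bandwidth_lower_bound[OF num])
  then have N: "2 * M \<le> 3 * real N" "N \<ge> 1" "real N \<le> M" "int N = P" unfolding N_def P_def by linarith+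
  have "0 \<le> P" using \<open>11 \<le> M\<close> by (simp add: P_def)
  then have "0 < T" by (simp add: T_def)
  \<comment> \<open>For \<open>J = 0\<close> nothing is killed locally, and \<open>\<delta>\<close> may be zero.\<close>
  define K where "K = (if J = 0 then 1 else 1 / (sqrt 2 * M * \<delta>))"
  have "K \<ge> 1"
  proof (cases "J = 0")
    case False
    have "0 < \<delta>" using True False by simp
    have "sqrt 2 * (M * \<delta>) \<le> 2 * (M * \<delta>)"
      using \<open>0 < \<delta>\<close> \<open>11 \<le> M\<close> by (intro mult_right_mono) (auto intro: real_le_lsqrt)
    then have "sqrt 2 * M * \<delta> \<le> 1" using \<delta> by (simp add: mult.assoc)
    then show ?thesis using False \<open>0 < \<delta>\<close> \<open>11 \<le> M\<close> by (simp add: K_def)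
  qed (simp add: K_def)
  \<comment> \<open>Shift that centres the one-sided spectrum \<open>[0, J N]\<^sup>d\<close> of the local factors.\<close>
  define c where "c = int J * int N div 2"
  have c: "2 * c \<le> int J * int N" "int J * int N \<le> 2 * c + 1" unfolding c_def by linarith+
  define \<eta> :: "real ^ 'd" where "\<eta> = (\<chi> i. - of_int c)"
  have "\<eta> \<in> int_box (- c) (- c)" by (simp add: \<eta>_def int_box_def int_lattice_def)
  then have shift: "multiplier X (int_box (-(P+q)) (P+q)) (int_box (-(P+q) - c) (P+q - c)) 1 (fourier_matrix \<eta>)"
    using int_box_add[of _ "-(P+q)" "P+q" \<eta> "-c" "-c"]
    by (intro multiplier_trigonometric[where A = "{\<eta>}" and c = "\<lambda>_. 1"]) auto
  obtain g where g: "g x0 = 1" "\<forall>y\<in>S. g y = 0"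
    "multiplier X (int_box (-(P+q) - c) (P+q - c)) (int_box (-(P+q) - c) (P+q - c + int J * int N)) (K ^ J) g"
  proof (cases "J = 0")
    case True
    then have "S = {}" using S X by (auto dest: finite_subset)
    then show ?thesis using that[of "\<lambda>_. 1"] True by (simp add: multiplier_def)
  next
    case False
    have "finite S" using S X by (auto dest: finite_subset)
    have "0 < \<delta>" using True False by simp
    obtain g where g: "g x0 = 1" "\<forall>y\<in>S. g y = 0"
      "multiplier X (int_box (-(P+q) - c) (P+q - c)) (int_box (-(P+q) - c) (P+q - c + int (card S) * int N)) (K ^ card S) g"
      using node_set_multiplier[OF \<open>finite S\<close> S(3) \<open>0 < \<delta>\<close> \<delta>(2) N(1,2), of X "-(P+q) - c" "P+q - c"] \<open>11 \<le> M\<close> False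
      by (auto simp: K_def)
    have "int (card S) * int N \<le> int J * int N" using S(2) by (intro mult_right_mono) auto
    then have "multiplier X (int_box (-(P+q) - c) (P+q - c)) (int_box (-(P+q) - c) (P+q - c + int J * int N)) (K ^ J) g"
      using S(2) \<open>K \<ge> 1\<close> by (intro multiplier_mono[OF g(3)] int_box_mono power_increasing) auto
    then show ?thesis using g(1,2) that by blast
  qed
  define C where "C = 1 / sqrt \<epsilon>"
  obtain h where h: "h x0 = 1" "\<forall>j<J. \<forall>y\<in>Z j - {x0}. h y = 0"
    "multiplier X (int_box (-(P+q) - c) (P+q - c + int J * int N))
      (int_box (-(P+q) - c - int J * (P + q)) (P+q - c + int J * int N + int J * (P + q))) (C ^ J) h"
  proof -
    have "finite (Z j) \<and> separated \<tau> (Z j) \<and> x0 \<in> Z j" if "j < J" for j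
      using Z[of j] X(1) that by (auto dest: finite_subset)
    then have "\<exists>h. h x0 = 1 \<and> (\<forall>j<J. \<forall>y\<in>Z j - {x0}. h y = 0) \<and>
      multiplier X (int_box (-(P+q) - c) (P+q - c + int J * int N))
        (int_box (-(P+q) - c - int J * (P + q)) (P+q - c + int J * int N + int J * (P + q))) (C ^ J) h"
      unfolding C_def \<epsilon>_def using True by (intro separated_family_multiplier[OF num P_def q_def]) auto
    then show ?thesis using that by blast
  qed
  define F where "F x = fourier_matrix \<eta> x * g x * h x" for x
  have "multiplier X (int_box (-(P+q)) (P+q))
      (int_box (-(P+q) - c - int J * (P + q)) (P+q - c + int J * int N + int J * (P + q))) (1 * K ^ J * C ^ J) F"
    unfolding F_def using \<open>K \<ge> 1\<close>
    by (intro multiplier_mult[OF multiplier_mult[OF shift g(3)] h(3)]) auto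
  moreover have "int_box (-(P+q) - c - int J * (P + q)) (P+q - c + int J * int N + int J * (P + q)) \<subseteq>
      (cube (2 * real (J + 1) * M) \<inter> int_lattice :: (real ^ 'd) set)"
    unfolding cube_int_lattice
  proof (rule int_box_mono)
    \<comment> \<open>The budget \<open>(J + 1) (3 M / 2) + (J M + 1) / 2 \<le> 2 (J + 1) M\<close>; the \<open>1/2\<close> is the rounding in \<open>c\<close>.\<close>
    have Pq: "real_of_int (P + q) \<le> 3/2 * M" unfolding P_def q_def of_int_add by linarith
    have "real J * real N \<le> real J * M" using N by (intro mult_left_mono) auto
    moreover have "real (J + 1) * of_int (P + q) \<le> real (J + 1) * (3/2 * M)" using Pq by (intro mult_left_mono) auto
    ultimately have le: "real (J + 1) * of_int (P + q) + (real J * real N + 1) / 2 \<le> 2 * real (J + 1) * M"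
      using \<open>11 \<le> M\<close> by (simp add: algebra_simps add_divide_distrib)
    have "real_of_int (2 * c) \<le> of_int (int J * int N)" "real_of_int (int J * int N) \<le> of_int (2 * c + 1)"
      using c by (simp_all only: of_int_le_iff)
    then have cr: "2 * real_of_int c \<le> real J * real N" "real J * real N \<le> 2 * of_int c + 1" by simp_all
    have "real_of_int (P+q - c + int J * int N + int J * (P + q)) \<le> 2 * real (J + 1) * M"
      using le cr by (simp add: algebra_simps add_divide_distrib)
    then show "P+q - c + int J * int N + int J * (P + q) \<le> \<lfloor>2 * real (J + 1) * M\<rfloor>" by (simp only: le_floor_iff)
    have "real_of_int (P+q + c + int J * (P + q)) \<le> 2 * real (J + 1) * M"
      using le cr by (simp add: algebra_simps add_divide_distrib)
    then have "P+q + c + int J * (P + q) \<le> \<lfloor>2 * real (J + 1) * M\<rfloor>" by (simp only: le_floor_iff)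
    then show "- \<lfloor>2 * real (J + 1) * M\<rfloor> \<le> -(P+q) - c - int J * (P + q)" by linarith
  qed
  ultimately have "multiplier X (int_box (-(P+q)) (P+q)) (cube (2 * real (J + 1) * M) \<inter> int_lattice) (1 * K ^ J * C ^ J) F"
    using \<open>K \<ge> 1\<close> \<epsilon> by (elim multiplier_mono) (auto simp: C_def cube_int_lattice)
  then have up: "l2_norm (int_box (-(P+q)) (P+q)) (fourier_op X (\<lambda>x. F x * u x)) \<le> K ^ J * C ^ J * ?l"
    by (simp add: multiplier_def)
  have ZJ: "Z J \<subseteq> X" "separated \<tau> (Z J)" "x0 \<in> Z J" "finite (Z J)" using Z[of J] X(1) by (auto dest: finite_subset)
  have "fourier_op X (\<lambda>x. F x * u x) = fourier_op (Z J) (\<lambda>x. F x * u x)"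
  proof
    fix \<omega>
    have "F x = 0" if "x \<in> X - Z J" for x
    proof -
      from that cover have "x \<in> S \<or> (\<exists>j<J. x \<in> Z j - {x0})"
        using ZJ(3) by (force simp: le_less)
      then show ?thesis using g(2) h(2) by (auto simp: F_def)
    qed
    then show "fourier_op X (\<lambda>x. F x * u x) \<omega> = fourier_op (Z J) (\<lambda>x. F x * u x) \<omega>"
      unfolding fourier_op_eq using X(1) ZJ(1) by (intro sum.mono_neutral_right) auto
  qed
  then have "T * \<epsilon> * (\<Sum>z\<in>Z J. (cmod (F z * u z))\<^sup>2) \<le> (l2_norm (int_box (-(P+q)) (P+q)) (fourier_op X (\<lambda>x. F x * u x)))\<^sup>2"
    using separated_l2_norm[OF num P_def q_def ZJ(4,2), of "\<lambda>x. F x * u x"] by (simp only: T_def \<epsilon>_def)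
  moreover have "(cmod (u x0))\<^sup>2 \<le> (\<Sum>z\<in>Z J. (cmod (F z * u z))\<^sup>2)"
    using member_le_sum[of x0 "Z J" "\<lambda>z. (cmod (F z * u z))\<^sup>2"] ZJ g(1) h(1) by (simp add: F_def norm_mult)
  ultimately have "T * \<epsilon> * (cmod (u x0))\<^sup>2 \<le> (l2_norm (int_box (-(P+q)) (P+q)) (fourier_op X (\<lambda>x. F x * u x)))\<^sup>2"
    using \<open>0 < T\<close> \<epsilon> by (meson mult_left_mono order_trans mult_nonneg_nonneg less_imp_le)
  then have "sqrt (T * \<epsilon> * (cmod (u x0))\<^sup>2) \<le> l2_norm (int_box (-(P+q)) (P+q)) (fourier_op X (\<lambda>x. F x * u x))"
    using l2_norm_nonneg by (intro real_le_lsqrt) auto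
  then have "sqrt (T * \<epsilon>) * cmod (u x0) \<le> K ^ J * C ^ J * ?l"
    using up by (simp add: real_sqrt_mult)
  then have "sqrt (T * \<epsilon>) * cmod (u x0) * (sqrt 2 * M * \<delta> * sqrt \<epsilon>) ^ J \<le> K ^ J * C ^ J * ?l * (sqrt 2 * M * \<delta> * sqrt \<epsilon>) ^ J"
    using \<delta> \<epsilon> \<open>11 \<le> M\<close> by (intro mult_right_mono) auto
  also have "\<dots> = ?l"
  proof (cases "J = 0")
    case False
    then have "K * C * (sqrt 2 * M * \<delta> * sqrt \<epsilon>) = 1" using True \<epsilon> \<open>11 \<le> M\<close> by (simp add: K_def C_def)
    then have "(K * C * (sqrt 2 * M * \<delta> * sqrt \<epsilon>)) ^ J = 1" by simp
    then have "K ^ J * C ^ J * (sqrt 2 * M * \<delta> * sqrt \<epsilon>) ^ J = 1" by (simp only: power_mult_distrib)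
    then show ?thesis by (simp add: mult_ac)
  qed simp
  finally show ?thesis by (simp only: T_def \<epsilon>_def P_def)
qed

lemma torus_lp_norm_1_le: "torus_lp_norm 1 (w :: real ^ 'd) \<le> real CARD('d) * torus_lp_norm \<infinity> w"
  unfolding torus_lp_norm_1 torus_lp_norm_infty
  using sum_bounded_above[of UNIV "\<lambda>i. \<bar>torus_rep w $ i\<bar>" "infnorm (torus_rep w)"]
  by (simp add: component_le_infnorm_cart)

text \<open>
  The lower bound as a function of the size \<open>V\<close> of the small cube, so that volumes and numbers of lattice points
  can be treated alike.
\<close>

definition clump_bound :: "nat \<Rightarrow> nat \<Rightarrow> real \<Rightarrow> real \<Rightarrow> real \<Rightarrow> real \<Rightarrow> real" where
  "clump_bound s lam \<beta> m \<delta> V = sqrt (2 / real s) * (1 - 1/2 * exp (1 / (2 * \<beta>))) powr (real lam / 2)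
     * sqrt V
     * (m * \<delta> / real lam) ^ (lam - 1)"

lemma min_sep_finiteD:
  assumes "min_sep N X = ereal \<delta>"
  shows "\<exists>x\<in>X. \<exists>y\<in>X. x \<noteq> y" "x \<in> X \<Longrightarrow> y \<in> X \<Longrightarrow> x \<noteq> y \<Longrightarrow> \<delta> \<le> N (x - y)"
proof -
  show "\<exists>x\<in>X. \<exists>y\<in>X. x \<noteq> y"
  proof (rule ccontr)
    assume "\<not> ?thesis"
    then have "{(x, y). x \<in> X \<and> y \<in> X \<and> x \<noteq> y} = {}" by auto
    then have "min_sep N X = \<infinity>" by (simp only: min_sep_def image_empty Inf_empty top_ereal_def)
    then show False using assms by simp
  qed
  assume "x \<in> X" "y \<in> X" "x \<noteq> y"
  then have "min_sep N X \<le> ereal (N (x - y))"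
    unfolding min_sep_def by (intro INF_lower2[of "(x, y)"]) auto
  then show "\<delta> \<le> N (x - y)" using assms by simp
qed

lemma min_sep_nonneg:
  assumes "min_sep N X = ereal \<delta>" "\<And>x. 0 \<le> N x"
  shows "0 \<le> \<delta>"
proof -
  have "0 \<le> min_sep N X" unfolding min_sep_def using assms(2) by (intro INF_greatest) auto
  then show ?thesis using assms(1) by simp
qed

lemma clumps_pos:
  assumes "consists_of_clumps N \<tau> lam X" "finite X" "X \<noteq> {}"
  shows "lam \<ge> 1"
proof -
  obtain r :: nat and C where C: "X = (\<Union>k\<in>{1..r}. C k)" "Max ((\<lambda>k. card (C k)) ` {1..r}) = lam"
    using assms(1) unfolding consists_of_clumps_def by auto
  obtain k x where k: "k \<in> {1..r}" "x \<in> C k" using assms(3) C(1) by blast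
  then have "finite (C k)" using assms(2) C(1) by (auto intro: finite_subset)
  then have "1 \<le> card (C k)" using k by (metis One_nat_def Suc_leI card_gt_0_iff empty_iff)
  also have "card (C k) \<le> lam" unfolding C(2)[symmetric] using k by (intro Max_ge) auto
  finally show ?thesis .
qed

text \<open>
  The nodes outside the clump of \<open>x0\<close> are labelled injectively within each clump by numbers below \<open>lam\<close>; nodes
  with equal labels lie in different clumps and are therefore separated, also from \<open>x0\<close>.
\<close>

lemma torus_clump_bound:
  fixes X :: "(real ^ 'd) set" and s lam :: nat and \<beta> m \<tau> \<delta> :: real
  assumes "CARD('d) \<ge> 2" "\<beta> \<ge> 1 / (2 * ln 2)" and X: "finite X" "card X = s" and "m > 0"
    and "\<delta> \<le> real lam / m" "2 * \<beta> * real CARD('d) * real lam / m \<le> \<tau>" "\<tau> \<le> 1 / (4 * real CARD('d))"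
    and clumps: "consists_of_clumps (torus_lp_norm \<infinity>) \<tau> lam X"
    and "X \<noteq> {}" "0 \<le> \<delta>"
    and sep: "\<And>x y. x \<in> X \<Longrightarrow> y \<in> X \<Longrightarrow> x \<noteq> y \<Longrightarrow> \<delta> \<le> torus_lp_norm 1 (x - y)"
    and u: "l2_norm X u = 1"
  shows "clump_bound s lam \<beta> m \<delta> (real (card (cube (m / (2 * real lam)) \<inter> int_lattice :: (real ^ 'd) set))) \<le> l2_norm (cube m \<inter> int_lattice) (fourier_op X u)"
proof -
  obtain r :: nat and C where C: "r \<ge> 1" "disjoint_family_on C {1..r}" "X = (\<Union>k\<in>{1..r}. C k)"
    "\<And>k x y. k \<in> {1..r} \<Longrightarrow> x \<in> C k \<Longrightarrow> y \<in> C k \<Longrightarrow> torus_lp_norm \<infinity> (x - y) \<le> \<tau>"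
    "Max ((\<lambda>k. card (C k)) ` {1..r}) = lam"
    "\<And>j k x y. j \<in> {1..r} \<Longrightarrow> k \<in> {1..r} \<Longrightarrow> j \<noteq> k \<Longrightarrow> x \<in> C j \<Longrightarrow> y \<in> C k \<Longrightarrow> \<tau> < torus_lp_norm \<infinity> (x - y)"
    using clumps unfolding consists_of_clumps_def by auto
  have finC: "finite (C k)" if "k \<in> {1..r}" for k
    using that C(3) X(1) by (auto intro: finite_subset)
  have cardC: "card (C k) \<le> lam" if "k \<in> {1..r}" for k
    unfolding C(5)[symmetric] using that by (intro Max_ge) auto
  have "s \<ge> 1" using X \<open>X \<noteq> {}\<close> by (metis One_nat_def Suc_leI card_gt_0_iff)
  have "\<exists>x0\<in>X. 1 / real s \<le> (cmod (u x0))\<^sup>2"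
  proof (rule ccontr)
    assume "\<not> ?thesis"
    then have "(\<Sum>x\<in>X. (cmod (u x))\<^sup>2) < real (card X) * (1 / real s)"
      using X \<open>X \<noteq> {}\<close> by (intro sum_bounded_above_strict) (auto simp: not_le card_gt_0_iff)
    moreover have "(\<Sum>x\<in>X. (cmod (u x))\<^sup>2) = 1" using u by (simp add: l2_norm_def)
    ultimately show False using X \<open>s \<ge> 1\<close> by simp
  qed
  then obtain x0 where x0: "x0 \<in> X" "1 / real s \<le> (cmod (u x0))\<^sup>2" by blast
  then obtain k0 where k0: "k0 \<in> {1..r}" "x0 \<in> C k0" using C(3) by auto
  have "lam \<ge> 1" by (rule clumps_pos[OF clumps X(1) \<open>X \<noteq> {}\<close>])
  define J where "J = lam - 1"
  have J: "lam = J + 1" using \<open>lam \<ge> 1\<close> by (simp add: J_def)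
  define M where "M = m / (2 * real lam)"
  have m: "m = 2 * real lam * M" using \<open>lam \<ge> 1\<close> by (simp add: M_def)
  have "M > 0" using \<open>m > 0\<close> \<open>lam \<ge> 1\<close> by (simp add: M_def)
  have \<beta>: "0 < \<beta>" using assms(2) ln_gt_zero[of 2] by (smt (verit) divide_pos_pos)
  have "0 < 2 * \<beta> * real CARD('d) * real lam / m" using \<beta> \<open>m > 0\<close> \<open>lam \<ge> 1\<close> by simp
  then have "0 < \<tau>" using assms(7) by linarith
  have "\<beta> * real CARD('d) / M \<le> \<tau>" using assms(7) \<open>lam \<ge> 1\<close> \<open>m > 0\<close> by (simp add: M_def field_simps)
  then have M\<tau>: "\<beta> * real CARD('d) \<le> M * \<tau>" using \<open>M > 0\<close> by (simp add: field_simps)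
  have "2 * M * \<delta> \<le> 1" using assms(6) \<open>lam \<ge> 1\<close> \<open>m > 0\<close> by (simp add: M_def field_simps)
  have "\<forall>k\<in>{1..r}. \<exists>f. inj_on f (C k) \<and> f ` C k \<subseteq> {..<lam}"
    using cardC finC by (simp add: inj_on_iff_card_le)
  then obtain L where L: "\<And>k. k \<in> {1..r} \<Longrightarrow> inj_on (L k) (C k) \<and> L k ` C k \<subseteq> {..<lam}"
    by metis
  have "\<forall>x\<in>X. \<exists>k. k \<in> {1..r} \<and> x \<in> C k" using C(3) by blast
  then obtain idx where idx: "\<And>x. x \<in> X \<Longrightarrow> idx x \<in> {1..r} \<and> x \<in> C (idx x)" by metis
  define Z where "Z j = insert x0 {y \<in> X - C k0. L (idx y) y = j}" for j
  define S where "S = C k0 - {x0}"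
  have "card S = card (C k0) - 1" using k0 finC by (simp add: S_def)
  then have "card S \<le> J" using cardC[OF k0(1)] by (simp add: J_def)
  have "S \<subseteq> X" using C(3) k0 by (auto simp: S_def)
  have "sqrt (of_int (2 * \<lfloor>M\<rfloor> + 1) ^ CARD('d) * (2 - exp (1 / (2 * \<beta>)))) * cmod (u x0) *
      (sqrt 2 * M * \<delta> * sqrt (2 - exp (1 / (2 * \<beta>)))) ^ J
    \<le> l2_norm (cube (2 * real (J + 1) * M) \<inter> int_lattice) (fourier_op X u)"
  proof (rule node_coefficient_bound[OF assms(1,2) \<open>0 < \<tau>\<close> assms(8) M\<tau> \<open>0 \<le> \<delta>\<close> \<open>2 * M * \<delta> \<le> 1\<close> X(1) x0(1) \<open>S \<subseteq> X\<close> \<open>card S \<le> J\<close>])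
    fix y assume y: "y \<in> S"
    then have "torus_lp_norm \<infinity> (x0 - y) \<le> \<tau>" using C(4) k0 by (auto simp: S_def)
    then have "torus_lp_norm \<infinity> (x0 - y) \<le> 1 / (4 * real CARD('d))" using assms(8) by linarith
    then have "real CARD('d) * torus_lp_norm \<infinity> (x0 - y) \<le> 1/4" using assms(1) by (simp add: field_simps)
    then have "torus_lp_norm 1 (x0 - y) \<le> 1/4" using torus_lp_norm_1_le[of "x0 - y"] by linarith
    moreover have "\<delta> \<le> torus_lp_norm 1 (x0 - y)"
      using sep[OF x0(1), of y] y \<open>S \<subseteq> X\<close> by (auto simp: S_def)
    ultimately show "\<delta> \<le> torus_lp_norm 1 (x0 - y) \<and> torus_lp_norm 1 (x0 - y) \<le> 1/4" by simp
  next
    fix j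
    have "\<tau> < torus_lp_norm \<infinity> (z - z')" if z: "z \<in> Z j" "z' \<in> Z j" "z \<noteq> z'" for z z'
    proof -
      \<comment> \<open>The index of a clump containing \<open>x\<close>, taken to be \<open>k0\<close> at \<open>x0\<close>.\<close>
      define id' where "id' x = (if x = x0 then k0 else idx x)" for x
      have id': "id' x \<in> {1..r} \<and> x \<in> C (id' x)" if "x \<in> Z j" for x
        using that idx k0 by (auto simp: id'_def Z_def)
      have "id' z \<noteq> id' z'"
      proof
        assume eq: "id' z = id' z'"
        have far: "idx x \<noteq> k0" "L (idx x) x = j" if "x \<in> Z j" "x \<noteq> x0" for x
          using that idx[of x] by (auto simp: Z_def)
        show False
        proof (cases "z = x0 \<or> z' = x0")
          case True
          then show False using eq far z by (auto simp: id'_def split: if_splits)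
        next
          case False
          then have same: "idx z = idx z'"
            using eq by (simp add: id'_def)
          have "L (idx z) z = L (idx z) z'"
            using far(2)[OF z(1)] far(2)[OF z(2)] False same by simp
          moreover have "z \<in> C (idx z)" "z' \<in> C (idx z')" "idx z \<in> {1..r}"
            using id'[OF z(1)] id'[OF z(2)] False by (auto simp: id'_def)
          ultimately show False using L[of "idx z"] z(3) same by (metis inj_onD)
        qed
      qed
      then show ?thesis using C(6) id'[OF z(1)] id'[OF z(2)] by blast
    qed
    then show "Z j \<subseteq> X \<and> separated \<tau> (Z j) \<and> x0 \<in> Z j"
      using x0 by (auto simp: Z_def separated_def)
  next
    show "X \<subseteq> S \<union> (\<Union>j\<le>J. Z j)"
    proof
      fix x assume x: "x \<in> X"
      have "L (idx x) x < lam" using L[of "idx x"] idx[OF x] by blast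
      then have "L (idx x) x \<le> J" using J by simp
      then show "x \<in> S \<union> (\<Union>j\<le>J. Z j)"
        using x by (cases "x \<in> C k0") (auto simp: S_def Z_def)
    qed
  qed
  moreover have "2 * real (J + 1) * M = m" using m J by simp
  ultimately have main: "sqrt (of_int (2 * \<lfloor>M\<rfloor> + 1) ^ CARD('d) * (2 - exp (1 / (2 * \<beta>)))) * cmod (u x0) *
      (sqrt 2 * M * \<delta> * sqrt (2 - exp (1 / (2 * \<beta>)))) ^ J
    \<le> l2_norm (cube m \<inter> int_lattice) (fourier_op X u)" by simp
  define \<epsilon> where "\<epsilon> = 1 - 1/2 * exp (1 / (2 * \<beta>))"
  define T where "T = real_of_int (2 * \<lfloor>M\<rfloor> + 1) ^ CARD('d)"
  have "1 / (2 * \<beta>) \<le> ln 2" using assms(2) \<beta> by (simp add: field_simps)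
  then have "exp (1 / (2 * \<beta>)) \<le> exp (ln 2)" by (simp only: exp_le_cancel_iff)
  then have "\<epsilon> \<ge> 0" by (simp add: \<epsilon>_def)
  have "T \<ge> 0" using \<open>M > 0\<close> by (simp add: T_def)
  have \<epsilon>2: "2 - exp (1 / (2 * \<beta>)) = 2 * \<epsilon>" by (simp add: \<epsilon>_def)
  have card: "real (card (cube M \<inter> int_lattice :: (real ^ 'd) set)) = T"
    using \<open>M > 0\<close> by (simp add: cube_int_lattice card_int_box T_def)
  have "\<epsilon> powr (real lam / 2) = sqrt \<epsilon> ^ lam"
    using \<open>\<epsilon> \<ge> 0\<close> \<open>lam \<ge> 1\<close> by (cases "\<epsilon> = 0") (simp_all add: powr_half_sqrt_powr[symmetric] powr_half_sqrt[symmetric] powr_realpow[symmetric] powr_powr)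
  then have "clump_bound s lam \<beta> m \<delta> (real (card (cube M \<inter> int_lattice :: (real ^ 'd) set))) = sqrt (2 / real s) * sqrt \<epsilon> ^ lam * sqrt T * (m * \<delta> / real lam) ^ J"
    unfolding clump_bound_def \<epsilon>_def[symmetric] M_def[symmetric] card J_def by simp
  also have "m * \<delta> / real lam = 2 * M * \<delta>" using \<open>lam \<ge> 1\<close> by (simp add: m)
  also have "sqrt (2 / real s) * sqrt \<epsilon> ^ lam * sqrt T * (2 * M * \<delta>) ^ J =
     sqrt (T * (2 * \<epsilon>)) * sqrt (1 / real s) * (sqrt \<epsilon> * (2 * M * \<delta>)) ^ J"
    unfolding J by (simp add: real_sqrt_mult real_sqrt_divide power_mult_distrib mult_ac)
  also have "sqrt \<epsilon> * (2 * M * \<delta>) = sqrt 2 * M * \<delta> * sqrt (2 * \<epsilon>)"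
    by (simp add: real_sqrt_mult mult_ac)
  also have "sqrt (T * (2 * \<epsilon>)) * sqrt (1 / real s) * (sqrt 2 * M * \<delta> * sqrt (2 * \<epsilon>)) ^ J \<le>
     sqrt (T * (2 * \<epsilon>)) * cmod (u x0) * (sqrt 2 * M * \<delta> * sqrt (2 * \<epsilon>)) ^ J"
    using x0(2) \<open>\<epsilon> \<ge> 0\<close> \<open>T \<ge> 0\<close> \<open>M > 0\<close> \<open>0 \<le> \<delta>\<close>
    by (intro mult_right_mono mult_left_mono real_le_lsqrt) auto
  also have "\<dots> \<le> l2_norm (cube m \<inter> int_lattice) (fourier_op X u)"
    using main unfolding \<epsilon>2 T_def .
  finally show ?thesis by (simp only: M_def)
qed

section \<open>From the torus to Euclidean space\<close>

lemma torus_rep_small: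
  assumes "\<And>i. \<bar>w $ i\<bar> < 1/2"
  shows "torus_rep w = w"
proof -
  have "round (w $ i) = 0" for i
    unfolding round_def using assms[of i] by (intro floor_unique) auto
  then show ?thesis by (simp add: torus_rep_def vec_eq_iff)
qed

lemma constant_box_measure:
  assumes "0 \<le> a"
  shows "measure lborel (cbox (\<chi> i. - a) (\<chi> i. a) :: (real ^ 'd) set) = (2 * a) ^ CARD('d)"
    "measure lborel (box (\<chi> i. - a) (\<chi> i. a) :: (real ^ 'd) set) = (2 * a) ^ CARD('d)"
proof -
  have "cbox (\<chi> i. - a) (\<chi> i. a) \<noteq> ({} :: (real ^ 'd) set)"
    using assms by (auto simp: interval_ne_empty_cart)
  then show c: "measure lborel (cbox (\<chi> i. - a) (\<chi> i. a) :: (real ^ 'd) set) = (2 * a) ^ CARD('d)"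
    by (subst content_cbox_cart) auto
  have "measure lborel (box (\<chi> i. - a) (\<chi> i. a) :: (real ^ 'd) set) = measure lborel (cbox (\<chi> i. - a) (\<chi> i. a) :: (real ^ 'd) set)"
    by (simp add: measure_lborel_box_eq measure_lborel_cbox_eq)
  then show "measure lborel (box (\<chi> i. - a) (\<chi> i. a) :: (real ^ 'd) set) = (2 * a) ^ CARD('d)"
    using c by simp
qed

lemma cube_eq_cbox: "cube a = cbox (\<chi> i. - a) (\<chi> i. a)"
  by (auto simp: cube_eq mem_box_cart abs_le_iff minus_le_iff)

lemma lborel_integral_translate:
  fixes f :: "real ^ 'd \<Rightarrow> real"
  assumes "f \<in> borel_measurable borel"
  shows "(LINT x|lborel. f (c + x)) = (LINT x|lborel. f x)"
proof -
  have "(LINT x|lborel. f x) = (LINT x|distr lborel borel ((+) c). f x)"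
    by (simp only: lborel_distr_plus)
  also have "\<dots> = (LINT x|lborel. f (c + x))"
    using assms by (intro integral_distr) auto
  finally show ?thesis ..
qed

text \<open>
  The cubes of side \<open>1/R\<close> centred at the points \<open>n / R\<close> are disjoint and fill the cube of
  half-width \<open>(K + 1/2) / R\<close>. Moving each of them to the origin, the integral over the large cube becomes the
  integral over one small cube of the sums over the translated lattices.
\<close>

lemma lattice_averaging:
  fixes F :: "real ^ 'd \<Rightarrow> real"
  assumes "R > 0" and cont: "continuous_on UNIV F" and "\<And>x. 0 \<le> F x"
    and B: "\<And>\<eta>. B \<le> (\<Sum>n\<in>cube (real K) \<inter> int_lattice. F ((1 / R) *\<^sub>R n + \<eta>))"
  shows "B / R ^ CARD('d) \<le> (LINT x:cube ((real K + 1/2) / R)|lebesgue. F x)"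
proof -
  define h where "h = 1 / (2 * R)"
  define V where "V = box (\<chi> i. - h) (\<chi> i. h :: real ^ 'd)"
  define Q where "Q = (cube ((real K + 1/2) / R) :: (real ^ 'd) set)"
  define \<Lambda> where "\<Lambda> = (cube (real K) \<inter> int_lattice :: (real ^ 'd) set)"
  have "h > 0" using assms(1) by (simp add: h_def)
  have memV: "x \<in> V \<longleftrightarrow> (\<forall>i. \<bar>x $ i\<bar> < h)" for x
    by (auto simp: V_def mem_box_cart abs_less_iff minus_less_iff)
  have Fm: "F \<in> borel_measurable borel" using cont by (rule borel_measurable_continuous_onI)
  have fin: "finite \<Lambda>" by (simp add: \<Lambda>_def cube_int_lattice)
  have cell: "(\<Sum>n\<in>\<Lambda>. indicator V (x - (1 / R) *\<^sub>R n)) \<le> (indicator Q x :: real)" for x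
  proof (cases "\<exists>n\<in>\<Lambda>. x - (1 / R) *\<^sub>R n \<in> V")
    case True
    then obtain n where n: "n \<in> \<Lambda>" "x - (1 / R) *\<^sub>R n \<in> V" by blast
    have uniq: "n' = n" if n': "n' \<in> \<Lambda>" "x - (1 / R) *\<^sub>R n' \<in> V" for n'
    proof -
      have "n' $ i = n $ i" for i
      proof -
        obtain a b where ab: "n $ i = of_int a" "n' $ i = of_int b"
          using n(1) n'(1) by (auto simp: \<Lambda>_def int_lattice_def) (metis Ints_cases)
        have "\<bar>x $ i - n $ i / R\<bar> < h" "\<bar>x $ i - n' $ i / R\<bar> < h"
          using n(2) n'(2) by (simp_all add: memV)
        then have "\<bar>x $ i - of_int a / R\<bar> < h" "\<bar>x $ i - of_int b / R\<bar> < h"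
          by (simp_all only: ab)
        then have "\<bar>of_int b / R - of_int a / R\<bar> < 1 / R" unfolding h_def by linarith
        then have "\<bar>real_of_int b - of_int a\<bar> < 1"
          using assms(1) by (simp add: diff_divide_distrib[symmetric] divide_less_cancel)
        then have "real_of_int \<bar>b - a\<bar> < 1" by simp
        then have "\<bar>b - a\<bar> < 1" by (simp only: of_int_less_1_iff)
        then show ?thesis using ab by simp
      qed
      then show ?thesis by (simp add: vec_eq_iff)
    qed
    have "(\<Sum>n'\<in>\<Lambda>. indicator V (x - (1 / R) *\<^sub>R n') :: real) = (\<Sum>n'\<in>\<Lambda>. if n' = n then 1 else 0)"
    proof (rule sum.cong[OF refl])
      fix n' assume "n' \<in> \<Lambda>"
      show "indicator V (x - (1 / R) *\<^sub>R n') = (if n' = n then 1 else 0 :: real)"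
      proof (cases "n' = n")
        case False
        then have "x - (1 / R) *\<^sub>R n' \<notin> V" using uniq[OF \<open>n' \<in> \<Lambda>\<close>] by blast
        then show ?thesis using False by simp
      qed (use n(2) in simp)
    qed
    also have "\<dots> = 1" using fin n by simp
    finally have "(\<Sum>n'\<in>\<Lambda>. indicator V (x - (1 / R) *\<^sub>R n') :: real) = 1" .
    moreover have "x \<in> Q"
      unfolding Q_def cube_eq
    proof (intro CollectI allI)
      fix i
      have "\<bar>n $ i\<bar> \<le> real K" using n(1) by (simp add: \<Lambda>_def cube_eq)
      then have "\<bar>n $ i / R\<bar> \<le> real K / R" using assms(1) by (simp add: divide_right_mono)
      moreover have "\<bar>x $ i - n $ i / R\<bar> < h" using n(2) by (simp add: memV)
      moreover have "(real K + 1/2) / R = real K / R + h" by (simp add: h_def add_divide_distrib)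
      ultimately show "\<bar>x $ i\<bar> \<le> (real K + 1/2) / R" by linarith
    qed
    ultimately show ?thesis by simp
  next
    case False
    then have "(\<Sum>n\<in>\<Lambda>. indicator V (x - (1 / R) *\<^sub>R n) :: real) = 0" by (intro sum.neutral) auto
    then show ?thesis by simp
  qed
  have int_compact: "integrable lborel (\<lambda>x. indicator S x *\<^sub>R G x)"
    if "S \<in> sets borel" "S \<subseteq> cbox a b" "continuous_on UNIV G" for S a b and G :: "real ^ 'd \<Rightarrow> real"
  proof -
    have "set_integrable lborel (cbox a b) G"
      unfolding set_integrable_def
      using that(3) by (intro borel_integrable_compact) (auto intro: continuous_on_subset)
    then have "set_integrable lborel S G" by (rule set_integrable_subset) (use that in auto)
    then show ?thesis by (simp add: set_integrable_def)
  qed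
  have VS: "V \<in> sets borel" "V \<subseteq> cbox (\<chi> i. - h) (\<chi> i. h)" by (auto simp: V_def box_subset_cbox)
  have QS: "Q \<in> sets borel" by (simp add: Q_def cube_eq_cbox)
  have intV: "integrable lborel (\<lambda>x. indicator V x * F ((1 / R) *\<^sub>R n + x))" for n
    using int_compact[OF VS, of "\<lambda>x. F ((1 / R) *\<^sub>R n + x)"] continuous_on_compose2[OF cont, of UNIV "\<lambda>x. (1 / R) *\<^sub>R n + x"]
    by (simp add: continuous_intros)
  have cellint: "integrable lborel (\<lambda>x. indicator V (x - (1 / R) *\<^sub>R n) * F x)" for n
  proof -
    have "(\<lambda>x. indicator V (x - (1 / R) *\<^sub>R n) * F x) = (\<lambda>x. indicator ((+) ((1 / R) *\<^sub>R n) ` V) x *\<^sub>R F x)"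
      by (auto simp: fun_eq_iff indicator_def image_iff algebra_simps)
    moreover have "(+) ((1 / R) *\<^sub>R n) ` V \<in> sets borel"
      unfolding V_def by (intro borel_open open_translation open_box)
    moreover have "(+) ((1 / R) *\<^sub>R n) ` V \<subseteq> cbox ((1 / R) *\<^sub>R n + (\<chi> i. - h)) ((1 / R) *\<^sub>R n + (\<chi> i. h))"
      unfolding cbox_translation using VS(2) by (rule image_mono)
    ultimately show ?thesis using int_compact cont by metis
  qed
  have translate: "(LINT x|lborel. indicator V (x - (1 / R) *\<^sub>R n) * F x) = (LINT x|lborel. indicator V x * F ((1 / R) *\<^sub>R n + x))" for n
  proof -
    have "(\<lambda>x. indicator V (x - (1 / R) *\<^sub>R n) * F x) \<in> borel_measurable borel"
      using borel_measurable_integrable[OF cellint] by simp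
    from lborel_integral_translate[OF this, of "(1 / R) *\<^sub>R n"] show ?thesis by simp
  qed
  have "2 * h = 1 / R" by (simp add: h_def)
  then have "measure lborel V = (1 / R) ^ CARD('d)"
    unfolding V_def using \<open>h > 0\<close> by (subst constant_box_measure(2)) auto
  then have "B / R ^ CARD('d) = measure lborel V * B"
    by (simp add: power_divide)
  also have "\<dots> = (LINT x|lborel. indicator V x * B)"
    by simp
  also have "\<dots> \<le> (LINT x|lborel. (\<Sum>n\<in>\<Lambda>. indicator V x * F ((1 / R) *\<^sub>R n + x)))"
  proof (rule integral_mono)
    show "integrable lborel (\<lambda>x. indicator V x * B)"
      using int_compact[OF VS, of "\<lambda>_. B"] by simp
    show "integrable lborel (\<lambda>x. \<Sum>n\<in>\<Lambda>. indicator V x * F ((1 / R) *\<^sub>R n + x))"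
      by (intro Bochner_Integration.integrable_sum intV)
    show "indicator V x * B \<le> (\<Sum>n\<in>\<Lambda>. indicator V x * F ((1 / R) *\<^sub>R n + x))" for x
      using B[of x] by (simp add: \<Lambda>_def indicator_def)
  qed
  also have "\<dots> = (\<Sum>n\<in>\<Lambda>. LINT x|lborel. indicator V x * F ((1 / R) *\<^sub>R n + x))"
    by (intro Bochner_Integration.integral_sum intV)
  also have "\<dots> = (\<Sum>n\<in>\<Lambda>. LINT x|lborel. indicator V (x - (1 / R) *\<^sub>R n) * F x)"
    by (simp only: translate)
  also have "\<dots> = (LINT x|lborel. (\<Sum>n\<in>\<Lambda>. indicator V (x - (1 / R) *\<^sub>R n) * F x))"
    by (intro Bochner_Integration.integral_sum[symmetric] cellint)
  also have "\<dots> \<le> (LINT x|lborel. indicator Q x * F x)"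
  proof (rule integral_mono)
    show "integrable lborel (\<lambda>x. \<Sum>n\<in>\<Lambda>. indicator V (x - (1 / R) *\<^sub>R n) * F x)"
      by (intro Bochner_Integration.integrable_sum cellint)
    show "integrable lborel (\<lambda>x. indicator Q x * F x)"
      using int_compact[OF QS, of _ _ F] cont by (auto simp: Q_def cube_eq_cbox)
    show "(\<Sum>n\<in>\<Lambda>. indicator V (x - (1 / R) *\<^sub>R n) * F x) \<le> indicator Q x * F x" for x
      unfolding sum_distrib_right[symmetric] using cell assms(3) by (intro mult_right_mono)
  qed
  also have "\<dots> = (LINT x|lebesgue. indicator Q x * F x)"
    using QS Fm by (intro integral_completion[symmetric]) auto
  also have "\<dots> = (LINT x:Q|lebesgue. F x)" by (simp add: set_lebesgue_integral_def)
  finally show ?thesis by (simp only: Q_def)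
qed

lemma continuous_on_fourier_op: "continuous_on A (fourier_op X u)"
  unfolding fourier_op_def by (intro continuous_intros)

lemma L2_norm_nonneg: "0 \<le> L2_norm \<Omega> f"
proof -
  have "0 \<le> (LINT \<omega>:\<Omega>|lebesgue. (cmod (f \<omega>))\<^sup>2)"
    unfolding set_lebesgue_integral_def by (intro Bochner_Integration.integral_nonneg) (auto simp: indicator_def)
  then show ?thesis by (simp add: L2_norm_def)
qed

lemma clump_bound_nonneg:
  assumes "0 \<le> m" "0 \<le> \<delta>" "0 \<le> V"
  shows "0 \<le> clump_bound s lam \<beta> m \<delta> V"
  using assms by (simp add: clump_bound_def)

lemma clump_bound_mono:
  assumes "0 \<le> m" "0 \<le> \<delta>" "V \<le> V'"
  shows "clump_bound s lam \<beta> m \<delta> V \<le> clump_bound s lam \<beta> m \<delta> V'"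
  using assms unfolding clump_bound_def by (intro mult_right_mono mult_left_mono) auto

lemma clump_bound_divide: "clump_bound s lam \<beta> m \<delta> V / sqrt W = clump_bound s lam \<beta> m \<delta> (V / W)"
  by (simp add: clump_bound_def real_sqrt_divide)

text \<open>
  With \<open>R = (K + 1/2) / m\<close> the nodes \<open>X / R\<close> are so close together that torus and Euclidean norms of their
  differences agree, and \<open>fourier_op X u\<close> on the lattice \<open>\<int>\<^sup>d / R + \<eta>\<close> is the operator of \<open>X / R\<close> on \<open>\<int>\<^sup>d\<close> with
  modulated coefficients. The half cell between \<open>K\<close> and \<open>K + 1/2\<close> is paid for by replacing \<open>m\<close> and \<open>\<beta>\<close> by
  multiples of \<open>K / (K + 1/2)\<close>, which keeps the condition on \<open>\<tau>\<close> intact.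
\<close>

lemma euclidean_clump_bound_scaled:
  fixes X :: "(real ^ 'd) set" and s lam K :: nat and \<beta> m \<tau> \<delta> :: real
  assumes "CARD('d) \<ge> 2" and X: "finite X" "card X = s" "X \<subseteq> torus_box" "X \<noteq> {}" and "m > 0"
    and "\<delta> \<le> real lam / m" "2 * \<beta> * real CARD('d) * real lam / m \<le> \<tau>" "\<tau> \<le> 1 / (4 * real CARD('d))"
    and clumps: "consists_of_clumps (lp_norm \<infinity>) \<tau> lam X"
    and "0 \<le> \<delta>"
    and sep: "\<And>x y. x \<in> X \<Longrightarrow> y \<in> X \<Longrightarrow> x \<noteq> y \<Longrightarrow> \<delta> \<le> lp_norm 1 (x - y)"
    and u: "l2_norm X u = 1" and "0 < \<tau>" "lam \<ge> 1"
    and K: "real K \<ge> 2 * m" "real K \<ge> real lam" "\<beta> * (real K / (real K + 1/2)) \<ge> 1 / (2 * ln 2)"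
  shows "clump_bound s lam (\<beta> * (real K / (real K + 1/2))) (m * (real K / (real K + 1/2))) \<delta>
      (((m / real lam) * (real K / (real K + 1/2)) - m / (real K + 1/2)) ^ CARD('d)) \<le> L2_norm (cube m) (fourier_op X u)"
proof -
  define q where "q = real K / (real K + 1/2)"
  define R where "R = (real K + 1/2) / m"
  have "K > 0" using K(1) \<open>m > 0\<close> by (metis gr0I not_le of_nat_0 zero_less_mult_iff zero_less_numeral)
  have R: "R > 0" "R \<ge> 2" using \<open>m > 0\<close> K(1) by (auto simp: R_def field_simps)
  have qR: "q = real K / (R * m)" using \<open>m > 0\<close> by (simp add: q_def R_def)
  define sc where "sc x = (1 / R) *\<^sub>R x" for x :: "real ^ 'd"
  have inj: "inj_on sc A" for A using R by (auto simp: inj_on_def sc_def)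
  have half: "\<bar>(sc x - sc y) $ i\<bar> < 1/2" if "x \<in> X" "y \<in> X" for x y i
  proof -
    have "- 1/2 \<le> x $ i" "x $ i < 1/2" "- 1/2 \<le> y $ i" "y $ i < 1/2"
      using that X(3) by (auto simp: torus_box_def subset_iff)
    then have "\<bar>x $ i - y $ i\<bar> < 1" by linarith
    then have "\<bar>x $ i - y $ i\<bar> < 1 / 2 * R" using R by linarith
    then have "\<bar>x $ i - y $ i\<bar> / R < 1 / 2" using R by (simp add: pos_divide_less_eq)
    then show ?thesis using R by (simp add: sc_def diff_divide_distrib[symmetric])
  qed
  have infty: "torus_lp_norm \<infinity> (sc x - sc y) = lp_norm \<infinity> (x - y) / R" if "x \<in> X" "y \<in> X" for x y
  proof -
    have "sc x - sc y = (1 / R) *\<^sub>R (x - y)" by (simp add: sc_def algebra_simps)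
    then show ?thesis
      using torus_rep_small[OF half[OF that]] R by (simp add: torus_lp_norm_infty lp_norm_infty infnorm_mul)
  qed
  have one: "torus_lp_norm 1 (sc x - sc y) = lp_norm 1 (x - y) / R" if "x \<in> X" "y \<in> X" for x y
  proof -
    have "sc x - sc y = (1 / R) *\<^sub>R (x - y)" by (simp add: sc_def algebra_simps)
    then show ?thesis
      using torus_rep_small[OF half[OF that]] R by (simp add: torus_lp_norm_1 lp_norm_1 sum_divide_distrib)
  qed
  have clumps': "consists_of_clumps (torus_lp_norm \<infinity>) (\<tau> / R) lam (sc ` X)"
  proof -
    obtain r :: nat and C where C: "r \<ge> 1" "disjoint_family_on C {1..r}" "X = (\<Union>k\<in>{1..r}. C k)"
      "\<forall>k\<in>{1..r}. \<forall>x\<in>C k. \<forall>y\<in>C k. lp_norm \<infinity> (x - y) \<le> \<tau>"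
      "Max ((\<lambda>k. card (C k)) ` {1..r}) = lam"
      "\<forall>j\<in>{1..r}. \<forall>k\<in>{1..r}. j \<noteq> k \<longrightarrow> (\<forall>x\<in>C j. \<forall>y\<in>C k. \<tau> < lp_norm \<infinity> (x - y))"
      using clumps unfolding consists_of_clumps_def by auto
    have sub: "x \<in> X" if "k \<in> {1..r}" "x \<in> C k" for k x using that C(3) by blast
    have "disjoint_family_on (\<lambda>k. sc ` C k) {1..r}"
      using C(2) unfolding disjoint_family_on_def
      by (metis inj image_Int image_empty sup_ge1 sup_ge2 inj_on_subset inj_on_image_Int)
    moreover have "sc ` X = (\<Union>k\<in>{1..r}. sc ` C k)" using C(3) by blast
    moreover have "\<forall>k\<in>{1..r}. \<forall>x\<in>sc ` C k. \<forall>y\<in>sc ` C k. torus_lp_norm \<infinity> (x - y) \<le> \<tau> / R"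
    proof (intro ballI)
      fix k x' y' assume k: "k \<in> {1..r}" "x' \<in> sc ` C k" "y' \<in> sc ` C k"
      then obtain x y where "x \<in> C k" "y \<in> C k" "x' = sc x" "y' = sc y" by blast
      then show "torus_lp_norm \<infinity> (x' - y') \<le> \<tau> / R"
        using k sub C(4) R infty by (simp add: divide_right_mono)
    qed
    moreover have "Max ((\<lambda>k. card (sc ` C k)) ` {1..r}) = lam"
      using C(5) by (simp add: card_image[OF inj])
    moreover have "\<forall>j\<in>{1..r}. \<forall>k\<in>{1..r}. j \<noteq> k \<longrightarrow> (\<forall>x\<in>sc ` C j. \<forall>y\<in>sc ` C k. \<tau> / R < torus_lp_norm \<infinity> (x - y))"
    proof (intro ballI impI)
      fix j k x' y' assume k: "j \<in> {1..r}" "k \<in> {1..r}" "j \<noteq> k" "x' \<in> sc ` C j" "y' \<in> sc ` C k"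
      then obtain x y where "x \<in> C j" "y \<in> C k" "x' = sc x" "y' = sc y" by blast
      then show "\<tau> / R < torus_lp_norm \<infinity> (x' - y')"
        using k sub C(6) R infty by (simp add: divide_strict_right_mono)
    qed
    ultimately show ?thesis
      unfolding consists_of_clumps_def using C(1) by (intro exI[of _ r] exI[of _ "\<lambda>k. sc ` C k"]) blast
  qed
  define cnt where "cnt = real (card (cube (real K / (2 * real lam)) \<inter> int_lattice :: (real ^ 'd) set))"
  define B where "B = clump_bound s lam (\<beta> * q) (real K) (\<delta> / R) cnt"
  have Bq: "B = clump_bound s lam (\<beta> * q) (m * q) \<delta> cnt"
    unfolding B_def clump_bound_def qR using \<open>m > 0\<close> by (simp add: mult_ac)
  have lower: "B \<le> l2_norm (cube (real K) \<inter> int_lattice) (\<lambda>n. fourier_op X u ((1 / R) *\<^sub>R n + \<eta>))" for \<eta>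
  proof -
    \<comment> \<open>Translating the lattice by \<open>\<eta>\<close> modulates the coefficients by unimodular factors.\<close>
    define u' where "u' y = u (R *\<^sub>R y) * fourier_matrix \<eta> (R *\<^sub>R y)" for y
    have unsc: "R *\<^sub>R sc x = x" for x using R by (simp add: sc_def)
    have norm_u': "l2_norm (sc ` X) u' = l2_norm X u"
      by (simp add: l2_norm_def sum.reindex[OF inj] u'_def unsc norm_mult)
    have "fourier_op (sc ` X) u' = (\<lambda>n. fourier_op X u ((1 / R) *\<^sub>R n + \<eta>))"
    proof
      fix n
      have "fourier_matrix n (sc x) = fourier_matrix ((1 / R) *\<^sub>R n) x" for x
        by (simp add: fourier_matrix_cis sc_def)
      then show "fourier_op (sc ` X) u' n = fourier_op X u ((1 / R) *\<^sub>R n + \<eta>)"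
        by (simp add: fourier_op_eq sum.reindex[OF inj] u'_def unsc fourier_matrix_add_left mult_ac)
    qed
    moreover have "B \<le> l2_norm (cube (real K) \<inter> int_lattice) (fourier_op (sc ` X) u')"
      unfolding B_def cnt_def
    proof (rule torus_clump_bound[OF assms(1) _ _ _ _ _ _ _ clumps'])
      show "1 / (2 * ln 2) \<le> \<beta> * q" using K(3) by (simp add: q_def)
      show "card (sc ` X) = s" using X by (simp add: card_image[OF inj])
      have "\<delta> / R \<le> real lam / m / R" using assms(7) R by (intro divide_right_mono) auto
      also have "\<dots> \<le> real lam / real K"
        unfolding R_def using \<open>K > 0\<close> \<open>m > 0\<close> by (simp add: frac_le)
      finally show "\<delta> / R \<le> real lam / real K" .
      have "2 * (\<beta> * q) * real CARD('d) * real lam / real K = 2 * \<beta> * real CARD('d) * real lam / m / R"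
        unfolding qR using \<open>K > 0\<close> by (simp add: mult_ac)
      also have "\<dots> \<le> \<tau> / R" using assms(8) R by (intro divide_right_mono) auto
      finally show "2 * (\<beta> * q) * real CARD('d) * real lam / real K \<le> \<tau> / R" .
      have "\<tau> / R \<le> \<tau>" using R \<open>0 < \<tau>\<close> by (simp add: divide_le_eq)
      then show "\<tau> / R \<le> 1 / (4 * real CARD('d))" using assms(9) by linarith
      show "\<delta> / R \<le> torus_lp_norm 1 (x - y)" if xy: "x \<in> sc ` X" "y \<in> sc ` X" "x \<noteq> y" for x y
      proof -
        obtain a b where ab: "a \<in> X" "b \<in> X" "x = sc a" "y = sc b" using xy(1,2) by blast
        then have "\<delta> \<le> lp_norm 1 (a - b)" using sep[of a b] xy(3) by blast
        then show ?thesis using ab one R by (simp add: divide_right_mono)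
      qed
      show "l2_norm (sc ` X) u' = 1" using norm_u' u by simp
    qed (use X \<open>K > 0\<close> R \<open>0 \<le> \<delta>\<close> in auto)
    ultimately show ?thesis by (simp only:)
  qed
  have "0 \<le> B" unfolding B_def cnt_def using R \<open>0 \<le> \<delta>\<close> by (intro clump_bound_nonneg) auto
  have "B\<^sup>2 / R ^ CARD('d) \<le> (LINT x:cube ((real K + 1/2) / R)|lebesgue. (cmod (fourier_op X u x))\<^sup>2)"
  proof (rule lattice_averaging[OF R(1)])
    show "continuous_on UNIV (\<lambda>x. (cmod (fourier_op X u x))\<^sup>2)"
      by (intro continuous_intros continuous_on_fourier_op)
    show "B\<^sup>2 \<le> (\<Sum>n\<in>cube (real K) \<inter> int_lattice. (cmod (fourier_op X u ((1 / R) *\<^sub>R n + \<eta>)))\<^sup>2)" for \<eta>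
      using power_mono[OF lower[of \<eta>] \<open>0 \<le> B\<close>, of 2] by (simp add: l2_norm_def sum_nonneg)
  qed auto
  moreover have "(real K + 1/2) / R = m" using \<open>m > 0\<close> by (simp add: R_def)
  ultimately have "sqrt (B\<^sup>2 / R ^ CARD('d)) \<le> L2_norm (cube m) (fourier_op X u)"
    by (simp add: L2_norm_def)
  then have "clump_bound s lam (\<beta> * q) (m * q) \<delta> (cnt / R ^ CARD('d)) \<le> L2_norm (cube m) (fourier_op X u)"
    using \<open>0 \<le> B\<close> unfolding clump_bound_divide[symmetric] Bq by (simp add: real_sqrt_divide)
  moreover have "((m / real lam) * q - m / (real K + 1/2)) ^ CARD('d) \<le> cnt / R ^ CARD('d)"
  proof -
    have 1: "(m / real lam) * q - m / (real K + 1/2) = (real K / real lam - 1) / R"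
    proof -
      have "(m / l) * (k / D) - m / D = (k / l - 1) / (D / m)" if "l > 0" "D > 0" for l k D :: real
        using that \<open>m > 0\<close> by (simp add: field_simps)
      from this[of "real lam" "real K + 1/2" "real K"] show ?thesis
        using \<open>lam \<ge> 1\<close> by (simp only: q_def R_def)
    qed
    have "0 \<le> real K / real lam - 1" using K(2) \<open>lam \<ge> 1\<close> by (simp add: field_simps)
    moreover have "cnt = of_int (2 * \<lfloor>real K / (2 * real lam)\<rfloor> + 1) ^ CARD('d)"
      by (simp add: cnt_def cube_int_lattice card_int_box)
    moreover have "real K / real lam - 1 \<le> of_int (2 * \<lfloor>real K / (2 * real lam)\<rfloor> + 1)"
    proof -
      have "real K / (2 * real lam) - 1 \<le> of_int \<lfloor>real K / (2 * real lam)\<rfloor>" by linarith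
      then show ?thesis by (simp add: field_simps)
    qed
    ultimately have "(real K / real lam - 1) ^ CARD('d) \<le> cnt" by (simp only: power_mono)
    then show ?thesis using R unfolding 1 power_divide by (intro divide_right_mono) auto
  qed
  moreover have "0 \<le> m * q" using \<open>m > 0\<close> by (simp add: q_def)
  ultimately show ?thesis
    using clump_bound_mono[OF _ \<open>0 \<le> \<delta>\<close>] unfolding q_def[symmetric] by (meson order_trans)
qed

text \<open>
  The limit of the scaled bound for large \<open>K\<close>. It needs room in the condition on \<open>\<beta>\<close>; at the boundary value
  \<open>\<beta> = 1 / (2 ln 2)\<close> the bound is zero.
\<close>

lemma euclidean_clump_bound:
  fixes X :: "(real ^ 'd) set" and s lam :: nat and \<beta> m \<tau> \<delta> :: real
  assumes "CARD('d) \<ge> 2" "\<beta> \<ge> 1 / (2 * ln 2)" and X: "finite X" "card X = s" "X \<subseteq> torus_box" "X \<noteq> {}" and "m > 0"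
    and "\<delta> \<le> real lam / m" "2 * \<beta> * real CARD('d) * real lam / m \<le> \<tau>" "\<tau> \<le> 1 / (4 * real CARD('d))"
    and clumps: "consists_of_clumps (lp_norm \<infinity>) \<tau> lam X"
    and "0 \<le> \<delta>"
    and sep: "\<And>x y. x \<in> X \<Longrightarrow> y \<in> X \<Longrightarrow> x \<noteq> y \<Longrightarrow> \<delta> \<le> lp_norm 1 (x - y)"
    and u: "l2_norm X u = 1"
  shows "clump_bound s lam \<beta> m \<delta> (measure lebesgue (cube (m / (2 * real lam)) :: (real ^ 'd) set)) \<le> L2_norm (cube m) (fourier_op X u)"
proof (cases "\<beta> = 1 / (2 * ln 2)")
  case True
  then have "clump_bound s lam \<beta> m \<delta> V = 0" for V by (simp add: clump_bound_def)
  then show ?thesis by (simp add: L2_norm_nonneg)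
next
  case False
  then have \<beta>: "1 / (2 * ln 2) < \<beta>" using assms(2) by simp
  moreover have "0 < 1 / (2 * ln 2 :: real)" by simp
  ultimately have "0 < \<beta>" by linarith
  have "lam \<ge> 1" by (rule clumps_pos[OF clumps X(1,4)])
  have "0 < 2 * \<beta> * real CARD('d) * real lam / m" using \<open>0 < \<beta>\<close> \<open>m > 0\<close> \<open>lam \<ge> 1\<close> by simp
  then have "0 < \<tau>" using assms(9) by linarith
  define q where "q K = real K / (real K + 1/2)" for K :: nat
  define p where "p K = m / (real K + 1/2)" for K :: nat
  have q: "q \<longlonglongrightarrow> 1" unfolding q_def by real_asymp
  have p: "p \<longlonglongrightarrow> 0" unfolding p_def by real_asymp
  have vol: "measure lebesgue (cube (m / (2 * real lam)) :: (real ^ 'd) set) = ((m / real lam) * 1 - 0) ^ CARD('d)"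
    using constant_box_measure(1)[of "m / (2 * real lam)", where 'd='d] \<open>m > 0\<close> by (simp add: cube_eq_cbox)
  have "1 / (2 * \<beta>) < ln 2" using \<beta> \<open>0 < \<beta>\<close> by (simp add: field_simps)
  then have "exp (1 / (2 * \<beta>)) < exp (ln 2)" by (simp only: exp_less_cancel_iff)
  then have nz: "1 - 1/2 * exp (1 / (2 * (\<beta> * 1))) \<noteq> 0" by simp
  have "(\<lambda>K. clump_bound s lam (\<beta> * q K) (m * q K) \<delta> (((m / real lam) * q K - p K) ^ CARD('d)))
      \<longlonglongrightarrow> clump_bound s lam (\<beta> * 1) (m * 1) \<delta> (((m / real lam) * 1 - 0) ^ CARD('d))"
    unfolding clump_bound_def using nz \<open>0 < \<beta>\<close> \<open>lam \<ge> 1\<close> by (intro tendsto_intros q p) auto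
  moreover have "\<forall>\<^sub>F K in sequentially. clump_bound s lam (\<beta> * q K) (m * q K) \<delta> (((m / real lam) * q K - p K) ^ CARD('d))
      \<le> L2_norm (cube m) (fourier_op X u)"
  proof -
    have "(\<lambda>K. \<beta> * q K) \<longlonglongrightarrow> \<beta> * 1" by (intro tendsto_intros q)
    then have "\<forall>\<^sub>F K in sequentially. 1 / (2 * ln 2) < \<beta> * q K" using \<beta> by (intro order_tendstoD) auto
    moreover have "\<forall>\<^sub>F K in sequentially. 2 * m \<le> real K"
      using filterlim_real_sequentially by (rule eventually_compose_filterlim[OF eventually_ge_at_top])
    moreover have "\<forall>\<^sub>F K in sequentially. lam \<le> K" by (rule eventually_ge_at_top)
    ultimately show ?thesis
    proof eventually_elim
      case (elim K)
      then show ?case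
        unfolding q_def p_def
        using assms(1,3-) \<open>0 < \<tau>\<close> \<open>lam \<ge> 1\<close>
        by (intro euclidean_clump_bound_scaled[where \<tau> = \<tau>]) auto
    qed
  qed
  ultimately have "clump_bound s lam (\<beta> * 1) (m * 1) \<delta> (((m / real lam) * 1 - 0) ^ CARD('d)) \<le> L2_norm (cube m) (fourier_op X u)"
    by (rule tendsto_upperbound) simp
  then show ?thesis by (simp only: vol mult_1_right)
qed

lemma exists_unit_coefficients:
  assumes "finite X" "X \<noteq> {}"
  shows "\<exists>u. l2_norm X u = 1"
proof -
  obtain x0 where "x0 \<in> X" using assms by blast
  then have "(\<Sum>x\<in>X. (cmod (if x = x0 then 1 else 0))\<^sup>2) = 1"
    using assms(1) by (simp add: if_distrib[of "\<lambda>z. (cmod z)\<^sup>2"] cong: if_cong)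
  then show ?thesis by (intro exI[of _ "\<lambda>x. if x = x0 then 1 else 0"]) (simp only: l2_norm_def real_sqrt_one)
qed

theorem corollary3p12:
  fixes X :: "(real ^ 'd) set"
    and s lam :: nat
    and \<beta> m \<tau> \<delta> :: real
  assumes "CARD('d) \<ge> 2"
    and "\<beta> \<ge> 1 / (2 * ln 2)"
    and "X \<subseteq> torus_box" and "finite X" and "card X = s"
    and "m \<ge> 4 * real s"
    and "\<delta> \<le> real lam / m"
    and "2 * \<beta> * real CARD('d) * real lam / m \<le> \<tau>" and "\<tau> \<le> 1 / (4 * real CARD('d))"
  shows
    "(consists_of_clumps (lp_norm \<infinity>) \<tau> lam X \<and> min_sep (lp_norm 1) X = ereal \<delta> \<longrightarrow>
       sigma_min_F (cube m) X \<ge>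
         sqrt (2 / real s) * (1 - 1/2 * exp (1 / (2 * \<beta>))) powr (real lam / 2)
         * sqrt (measure lebesgue (cube (m / (2 * real lam)) :: (real ^ 'd) set))
         * (m * \<delta> / real lam) ^ (lam - 1)) \<and>
     (consists_of_clumps (torus_lp_norm \<infinity>) \<tau> lam X \<and> min_sep (torus_lp_norm 1) X = ereal \<delta> \<longrightarrow>
       sigma_min_Phi (cube m) X \<ge>
         sqrt (2 / real s) * (1 - 1/2 * exp (1 / (2 * \<beta>))) powr (real lam / 2)
         * sqrt (real (card (cube (m / (2 * real lam)) \<inter> int_lattice :: (real ^ 'd) set)))
         * (m * \<delta> / real lam) ^ (lam - 1))"
proof (intro conjI impI; elim conjE)
  assume clumps: "consists_of_clumps (lp_norm \<infinity>) \<tau> lam X" and sep: "min_sep (lp_norm 1) X = ereal \<delta>"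
  have X: "X \<noteq> {}" using min_sep_finiteD(1)[OF sep] by blast
  then have "m > 0" using assms(4-6) by (metis card_gt_0_iff less_le_trans mult_pos_pos of_nat_0_less_iff zero_less_numeral)
  have "clump_bound s lam \<beta> m \<delta> (measure lebesgue (cube (m / (2 * real lam)) :: (real ^ 'd) set)) \<le> sigma_min_F (cube m) X"
    unfolding sigma_min_F_def
  proof (rule cINF_greatest)
    show "{u. l2_norm X u = 1} \<noteq> {}" using exists_unit_coefficients[OF assms(4) X] by blast
    fix u assume "u \<in> {u. l2_norm X u = 1}"
    then show "clump_bound s lam \<beta> m \<delta> (measure lebesgue (cube (m / (2 * real lam)) :: (real ^ 'd) set)) \<le> L2_norm (cube m) (fourier_op X u)"
      using assms clumps X \<open>m > 0\<close> min_sep_nonneg[OF sep lp_norm_nonneg] min_sep_finiteD(2)[OF sep]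
      by (intro euclidean_clump_bound) auto
  qed
  then show "sigma_min_F (cube m) X \<ge>
         sqrt (2 / real s) * (1 - 1/2 * exp (1 / (2 * \<beta>))) powr (real lam / 2)
         * sqrt (measure lebesgue (cube (m / (2 * real lam)) :: (real ^ 'd) set))
         * (m * \<delta> / real lam) ^ (lam - 1)"
    by (simp only: clump_bound_def)
next
  assume clumps: "consists_of_clumps (torus_lp_norm \<infinity>) \<tau> lam X" and sep: "min_sep (torus_lp_norm 1) X = ereal \<delta>"
  have X: "X \<noteq> {}" using min_sep_finiteD(1)[OF sep] by blast
  then have "m > 0" using assms(4-6) by (metis card_gt_0_iff less_le_trans mult_pos_pos of_nat_0_less_iff zero_less_numeral)
  have "clump_bound s lam \<beta> m \<delta> (real (card (cube (m / (2 * real lam)) \<inter> int_lattice :: (real ^ 'd) set))) \<le> sigma_min_Phi (cube m) X"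
    unfolding sigma_min_Phi_def
  proof (rule cINF_greatest)
    show "{u. l2_norm X u = 1} \<noteq> {}" using exists_unit_coefficients[OF assms(4) X] by blast
    fix u assume u: "u \<in> {u. l2_norm X u = 1}"
    have "(\<lambda>\<omega>. \<Sum>x\<in>X. fourier_matrix \<omega> x * u x) = fourier_op X u"
      by (simp add: fun_eq_iff fourier_op_eq mult.commute)
    moreover have "clump_bound s lam \<beta> m \<delta> (real (card (cube (m / (2 * real lam)) \<inter> int_lattice :: (real ^ 'd) set)))
       \<le> l2_norm (cube m \<inter> int_lattice) (fourier_op X u)"
      using u assms clumps X \<open>m > 0\<close> min_sep_nonneg[OF sep torus_lp_norm_nonneg] min_sep_finiteD(2)[OF sep]
      by (intro torus_clump_bound) auto
    ultimately show "clump_bound s lam \<beta> m \<delta> (real (card (cube (m / (2 * real lam)) \<inter> int_lattice :: (real ^ 'd) set)))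
       \<le> l2_norm (cube m \<inter> int_lattice) (\<lambda>\<omega>. \<Sum>x\<in>X. fourier_matrix \<omega> x * u x)" by simp
  qed
  then show "sigma_min_Phi (cube m) X \<ge>
         sqrt (2 / real s) * (1 - 1/2 * exp (1 / (2 * \<beta>))) powr (real lam / 2)
         * sqrt (real (card (cube (m / (2 * real lam)) \<inter> int_lattice :: (real ^ 'd) set)))
         * (m * \<delta> / real lam) ^ (lam - 1)"
    by (simp only: clump_bound_def)
qed

end
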